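(* Let $M=\mathbb{H}^3/\Gamma$ be an arithmetic hyperbolic 3-manifold. Then $M$ is commensurable with an arithmetic hyperbolic 3-orbifold with non-empty singular locus. More precisely, $\Gamma$ is commensurable with an arithmetic Kleinian group $\Gamma_0$ containing an element of order $2$.
   Context: Arithmetic Kleinian groups: let $k$ be a number field with exactly one complex place, $B$ a quaternion algebra over $k$ ramified at all real places of $k$, $\rho: B\to M(2,\mathbb{C})$ an embedding, $\mathcal{O}$ an order of $B$, and $\mathcal{O}^1$ its group of elements of norm one. Let $\mathrm{P}\rho(\mathcal{O}^1)$ be the image of $\rho(\mathcal{O}^1)$ in $\mathrm{PSL}(2,\mathbb{C})$. A subgroup of $\mathrm{PSL}(2,\mathbb{C})$ is an arithmetic Kleinian group if it is commensurable with some such $\mathrm{P}\rho(\mathcal{O}^1)$. A hyperbolic 3-orbifold (or 3-manifold) $\mathbb{H}^3/\Gamma$ is arithmetic if $\Gamma$ is an arithmetic Kleinian group; it is a manifold when $\Gamma$ is torsion-free. Two subgroups of $\mathrm{PSL}(2,\mathbb{C})$ are commensurable if their intersection has finite index in both; two orbifolds are commensurable if they have a common finite-sheeted cover. *)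

theory Defs
  imports
    "HOL-Analysis.Analysis"
    "HOL-Algebra.Algebra"
    "HOL-Algebra.Algebraic_Closure_Type"
begin

(* otherwise ambiguous with vec_nth *)
no_notation fps_nth (infixl "$" 75)

section \<open>Groups of Moebius transformations\<close>

definition SL2C :: "(complex^2^2) monoid" where
  "SL2C = \<lparr>carrier = {A. det A = 1}, monoid.mult = (**), one = mat 1\<rparr>"

definition PSL2C :: "(complex^2^2) set monoid" where
  "PSL2C = SL2C Mod {mat 1, - mat 1}"

definition PSL_proj :: "complex^2^2 \<Rightarrow> (complex^2^2) set" where
  "PSL_proj A = {mat 1, - mat 1} #>\<^bsub>SL2C\<^esub> A"

lemma group_SL2C: "group SL2C"
proof (rule groupI)
  fix A assume "A \<in> carrier SL2C"
  then have "invertible A" "det A = 1"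
    by (auto simp: SL2C_def invertible_det_nz)
  then obtain B where "B ** A = mat 1"
    by (auto simp: invertible_def)
  with \<open>det A = 1\<close> show "\<exists>B\<in>carrier SL2C. B \<otimes>\<^bsub>SL2C\<^esub> A = \<one>\<^bsub>SL2C\<^esub>"
    by (intro bexI[of _ B]) (auto simp: SL2C_def dest: arg_cong[of _ _ det] simp: det_mul)
qed (auto simp: SL2C_def det_mul matrix_mul_assoc)

lemma det_uminus_2: "det (- A) = det (A :: complex^2^2)"
  by (simp add: det_2)

lemma matrix_mult_uminus:
  "(- A) ** B = - (A ** B)" "A ** (- B) = - (A ** (B :: complex^2^2))"
  by (simp_all add: matrix_matrix_mult_def vec_eq_iff sum_negf)

lemma normal_center_SL2C: "{mat 1, - mat 1} \<lhd> SL2C"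
proof -
  interpret group SL2C by (rule group_SL2C)
  have "subgroup {mat 1, - mat 1} SL2C"
  proof (rule subgroupI)
    fix A assume A: "A \<in> {mat 1, - mat 1 :: complex^2^2}"
    have "inv\<^bsub>SL2C\<^esub> A = A"
      by (rule inv_equality) (use A in \<open>auto simp: SL2C_def matrix_mult_uminus det_uminus_2\<close>)
    then show "inv\<^bsub>SL2C\<^esub> A \<in> {mat 1, - mat 1}" using A by simp
  qed (auto simp: SL2C_def matrix_mult_uminus det_uminus_2)
  then show ?thesis
    by (rule normalI) (auto simp: r_coset_def l_coset_def SL2C_def matrix_mult_uminus)
qed

lemma group_PSL2C: "group PSL2C"
  unfolding PSL2C_def by (rule normal.factorgroup_is_group[OF normal_center_SL2C])

lemma PSL_proj_eq: "PSL_proj A = {A, - A}"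
  by (auto simp: PSL_proj_def r_coset_def SL2C_def matrix_mult_uminus)

definition finite_index :: "('a, 'b) monoid_scheme \<Rightarrow> 'a set \<Rightarrow> 'a set \<Rightarrow> bool" where
  "finite_index G H K \<longleftrightarrow> finite (rcosets\<^bsub>G\<lparr>carrier := K\<rparr>\<^esub> H)"

definition commensurable :: "('a, 'b) monoid_scheme \<Rightarrow> 'a set \<Rightarrow> 'a set \<Rightarrow> bool" where
  "commensurable G H K \<longleftrightarrow> finite_index G (H \<inter> K) H \<and> finite_index G (H \<inter> K) K"

definition torsion_free :: "('a, 'b) monoid_scheme \<Rightarrow> 'a set \<Rightarrow> bool" where
  "torsion_free G H \<longleftrightarrow> (\<forall>g\<in>H. \<forall>n::nat. n > 0 \<and> g [^]\<^bsub>G\<^esub> n = \<one>\<^bsub>G\<^esub> \<longrightarrow> g = \<one>\<^bsub>G\<^esub>)"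


section \<open>Hyperbolic 3-orbifolds\<close>

text \<open>The upper half-space model of hyperbolic 3-space.\<close>

definition H3 :: "(complex \<times> real) set" where
  "H3 = {(z, t). t > 0}"

definition H3_dist :: "complex \<times> real \<Rightarrow> complex \<times> real \<Rightarrow> real" where
  "H3_dist = (\<lambda>(z, s) (w, t). arcosh (1 + ((cmod (z - w))\<^sup>2 + (s - t)\<^sup>2) / (2 * s * t)))"

definition H3_isometry :: "(complex \<times> real \<Rightarrow> complex \<times> real) \<Rightarrow> bool" where
  "H3_isometry \<phi> \<longleftrightarrow> bij_betw \<phi> H3 H3 \<and> (\<forall>p\<in>H3. \<forall>q\<in>H3. H3_dist (\<phi> p) (\<phi> q) = H3_dist p q)"

text \<open>Poincare extension to \<^const>\<open>H3\<close> of the Moebius transformation of a matrix of determinant 1.\<close>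

definition Poincare_extension :: "complex^2^2 \<Rightarrow> complex \<times> real \<Rightarrow> complex \<times> real" where
  "Poincare_extension A = (\<lambda>(z, t).
     let a = A$1$1; b = A$1$2; c = A$2$1; d = A$2$2;
         N = (cmod (c * z + d))\<^sup>2 + (cmod c)\<^sup>2 * t\<^sup>2
     in (((a * z + b) * cnj (c * z + d) + a * cnj c * of_real (t\<^sup>2)) / of_real N, t / N))"

text \<open>The choice of the representative is immaterial, see \<open>PSL_act_proj\<close>.\<close>

definition PSL_act :: "(complex^2^2) set \<Rightarrow> complex \<times> real \<Rightarrow> complex \<times> real" where
  "PSL_act g = Poincare_extension (SOME A. A \<in> g)"

lemma Poincare_extension_uminus: "Poincare_extension (- A) = Poincare_extension A"
proof -
  have "- (A$2$1 * z) - A$2$2 = - (A$2$1 * z + A$2$2)" for z by simp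
  then have "cmod (- (A$2$1 * z) - A$2$2) = cmod (A$2$1 * z + A$2$2)" for z
    by (metis norm_minus_cancel)
  then show ?thesis
    by (auto simp: Poincare_extension_def Let_def fun_eq_iff algebra_simps)
qed

lemma PSL_act_proj: "PSL_act (PSL_proj A) = Poincare_extension A"
proof -
  have "(SOME B. B \<in> PSL_proj A) \<in> {A, - A}"
    by (metis (mono_tags) PSL_proj_eq insertI1 someI)
  then show ?thesis
    by (auto simp: PSL_act_def Poincare_extension_uminus)
qed

text \<open>The points of \<open>\<H>\<^sup>3/\<Gamma>\<close> are the orbits; those with non-trivial isotropy form the singular
  locus.\<close>

definition H3_orbit :: "(complex^2^2) set set \<Rightarrow> complex \<times> real \<Rightarrow> (complex \<times> real) set" where
  "H3_orbit \<Gamma> p = (\<lambda>g. PSL_act g p) ` \<Gamma>"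

definition singular_locus :: "(complex^2^2) set set \<Rightarrow> (complex \<times> real) set set" where
  "singular_locus \<Gamma> = {H3_orbit \<Gamma> p | p. p \<in> H3 \<and> (\<exists>g\<in>\<Gamma>. g \<noteq> \<one>\<^bsub>PSL2C\<^esub> \<and> PSL_act g p = p)}"

text \<open>A finite-sheeted cover \<open>\<H>\<^sup>3/\<Lambda> \<rightarrow> \<H>\<^sup>3/\<Gamma>\<close> of hyperbolic orbifolds is a map which lifts to an
  isometry \<open>\<phi>\<close> of hyperbolic space such that \<open>\<phi> \<Lambda> \<phi>\<^sup>-\<^sup>1\<close> is a subgroup of finite index of
  \<open>\<Gamma>\<close>.\<close>

definition finite_orbifold_cover ::
  "(complex^2^2) set set \<Rightarrow> (complex^2^2) set set
    \<Rightarrow> ((complex \<times> real) set \<Rightarrow> (complex \<times> real) set) \<Rightarrow> bool" where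
  "finite_orbifold_cover \<Lambda> \<Gamma> \<pi> \<longleftrightarrow>
     (\<exists>\<phi>. H3_isometry \<phi> \<and>
          (\<forall>p\<in>H3. \<pi> (H3_orbit \<Lambda> p) = H3_orbit \<Gamma> (\<phi> p)) \<and>
          (\<forall>h\<in>\<Lambda>. \<exists>g\<in>\<Gamma>. \<forall>p\<in>H3. \<phi> (PSL_act h p) = PSL_act g (\<phi> p)) \<and>
          finite_index PSL2C
            {g\<in>\<Gamma>. \<exists>h\<in>\<Lambda>. \<forall>p\<in>H3. \<phi> (PSL_act h p) = PSL_act g (\<phi> p)} \<Gamma>)"

definition orbifold_commensurable ::
  "(complex^2^2) set set \<Rightarrow> (complex^2^2) set set \<Rightarrow> bool" where
  "orbifold_commensurable \<Gamma>\<^sub>1 \<Gamma>\<^sub>2 \<longleftrightarrow>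
     (\<exists>\<Lambda> \<pi>\<^sub>1 \<pi>\<^sub>2. subgroup \<Lambda> PSL2C \<and>
        finite_orbifold_cover \<Lambda> \<Gamma>\<^sub>1 \<pi>\<^sub>1 \<and> finite_orbifold_cover \<Lambda> \<Gamma>\<^sub>2 \<pi>\<^sub>2)"


section \<open>Number fields\<close>

text \<open>Number fields are represented by subfields of the complex numbers; every number field is
  isomorphic to one of these.\<close>

abbreviation CC :: "complex ring" where
  "CC \<equiv> ring_of_type_algebra"

definition number_field :: "complex set \<Rightarrow> bool" where
  "number_field k \<longleftrightarrow> subfield k CC \<and> ring.finite_dimension CC \<rat> k"

definition ring_of_integers :: "complex set \<Rightarrow> complex set" where
  "ring_of_integers k = {x \<in> k. algebraic_int x}"

text \<open>The inclusion of \<open>k\<close> is only one of the embeddings and plays no special role. Embeddings are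
  taken to be extensional so that distinct elements differ on \<open>k\<close>.\<close>

definition embeddings :: "complex set \<Rightarrow> (complex \<Rightarrow> complex) set" where
  "embeddings k = ring_hom (CC\<lparr>carrier := k\<rparr>) CC \<inter> extensional k"

definition real_embeddings :: "complex set \<Rightarrow> (complex \<Rightarrow> complex) set" where
  "real_embeddings k = {\<tau> \<in> embeddings k. \<tau> ` k \<subseteq> \<real>}"

definition complex_embeddings :: "complex set \<Rightarrow> (complex \<Rightarrow> complex) set" where
  "complex_embeddings k = embeddings k - real_embeddings k"

definition complex_places :: "complex set \<Rightarrow> (complex \<Rightarrow> complex) set set" where
  "complex_places k = (\<lambda>\<sigma>. {\<sigma>, restrict (cnj \<circ> \<sigma>) k}) ` complex_embeddings k"


section \<open>Quaternion algebras\<close>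

text \<open>The quaternion algebra with Hilbert symbol \<open>(a, b / K)\<close>, for non-zero \<open>a\<close>, \<open>b\<close> in a field
  \<open>K\<close>: it has the \<open>K\<close>-basis \<open>1, i, j, ij\<close>, with
  \<open>i\<^sup>2 = a\<close>, \<open>j\<^sup>2 = b\<close>, \<open>ij = -ji\<close>. The components of a vector are the coordinates in this basis.\<close>

definition quaternion_mult :: "complex \<Rightarrow> complex \<Rightarrow> complex^4 \<Rightarrow> complex^4 \<Rightarrow> complex^4" where
  "quaternion_mult a b x y = vector
    [x$1 * y$1 + a * (x$2 * y$2) + b * (x$3 * y$3) - a * b * (x$4 * y$4),
     x$1 * y$2 + x$2 * y$1 - b * (x$3 * y$4) + b * (x$4 * y$3),
     x$1 * y$3 + x$3 * y$1 + a * (x$2 * y$4) - a * (x$4 * y$2),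
     x$1 * y$4 + x$4 * y$1 + x$2 * y$3 - x$3 * y$2]"

definition quaternion_algebra :: "complex set \<Rightarrow> complex \<Rightarrow> complex \<Rightarrow> (complex^4) ring" where
  "quaternion_algebra K a b =
     \<lparr>carrier = {x. \<forall>n. x$n \<in> K}, monoid.mult = quaternion_mult a b, one = vector [1, 0, 0, 0],
      ring.zero = 0, add = (+)\<rparr>"

lemma vector_4:
  "(vector [w, x, y, z] :: 'a::zero^4)$1 = w" "(vector [w, x, y, z] :: 'a::zero^4)$2 = x"
  "(vector [w, x, y, z] :: 'a::zero^4)$3 = y" "(vector [w, x, y, z] :: 'a::zero^4)$4 = z"
  unfolding vector_def by simp_all

definition reduced_norm :: "complex \<Rightarrow> complex \<Rightarrow> complex^4 \<Rightarrow> complex" where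
  "reduced_norm a b x = (x$1)\<^sup>2 - a * (x$2)\<^sup>2 - b * (x$3)\<^sup>2 + a * b * (x$4)\<^sup>2"

text \<open>\<open>B = (a, b / k)\<close> is ramified at \<open>\<tau>\<close> if the extension of scalars of \<open>B\<close> along
  \<open>\<tau> : k \<rightarrow> \<real>\<close>, that is \<open>(\<tau> a, \<tau> b / \<real>)\<close>, is a division algebra.\<close>

definition ramified_at :: "complex \<Rightarrow> complex \<Rightarrow> (complex \<Rightarrow> complex) \<Rightarrow> bool" where
  "ramified_at a b \<tau> \<longleftrightarrow>
     (let H = quaternion_algebra \<real> (\<tau> a) (\<tau> b) in Units H = carrier H - {\<zero>\<^bsub>H\<^esub>})"

definition linear_span :: "complex set \<Rightarrow> (complex^4) set \<Rightarrow> (complex^4) set" where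
  "linear_span R S = {\<Sum>s\<in>T. c s *s s | c T. finite T \<and> T \<subseteq> S \<and> c ` T \<subseteq> R}"

definition quaternion_order ::
  "complex set \<Rightarrow> complex \<Rightarrow> complex \<Rightarrow> (complex^4) set \<Rightarrow> bool" where
  "quaternion_order k a b \<O> \<longleftrightarrow>
     subring \<O> (quaternion_algebra k a b) \<and>
     (\<exists>S. finite S \<and> \<O> = linear_span (ring_of_integers k) S) \<and>
     linear_span k \<O> = carrier (quaternion_algebra k a b)"

definition norm_one_group :: "complex \<Rightarrow> complex \<Rightarrow> (complex^4) set \<Rightarrow> (complex^4) set" where
  "norm_one_group a b \<O> = {x \<in> \<O>. reduced_norm a b x = 1}"

definition M2C :: "(complex^2^2) ring" where
  "M2C = \<lparr>carrier = UNIV, monoid.mult = (**), one = mat 1, ring.zero = 0, add = (+)\<rparr>"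

text \<open>An embedding of \<open>B\<close> in the algebra of complex matrices is an embedding of \<open>k\<close>-algebras,
  where \<open>k\<close> acts on matrices through \<open>\<sigma>\<close>.\<close>

definition algebra_embedding ::
  "complex set \<Rightarrow> complex \<Rightarrow> complex \<Rightarrow> (complex \<Rightarrow> complex) \<Rightarrow> (complex^4 \<Rightarrow> complex^2^2) \<Rightarrow> bool"
where
  "algebra_embedding k a b \<sigma> \<rho> \<longleftrightarrow>
     \<rho> \<in> ring_hom (quaternion_algebra k a b) M2C \<and>
     inj_on \<rho> (carrier (quaternion_algebra k a b)) \<and>
     (\<forall>c\<in>k. \<forall>x\<in>carrier (quaternion_algebra k a b). \<rho> (c *s x) = mat (\<sigma> c) ** \<rho> x)"

lemma ring_quaternion_algebra:
  assumes K: "subring K CC" and ab: "a \<in> K" "b \<in> K"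
  shows "ring (quaternion_algebra K a b)"
proof -
  interpret CC: ring CC by (rule ring_from_type_algebra)
  have minus_CC: "\<ominus>\<^bsub>CC\<^esub> x = - x" for x
    by (rule CC.minus_equality) (simp_all add: ring_of_type_algebra_def)
  have closed: "0 \<in> K" "1 \<in> K" "\<And>x y. x \<in> K \<Longrightarrow> y \<in> K \<Longrightarrow> x + y \<in> K"
    "\<And>x y. x \<in> K \<Longrightarrow> y \<in> K \<Longrightarrow> x * y \<in> K" "\<And>x. x \<in> K \<Longrightarrow> - x \<in> K"
    using subringE[OF K] by (auto simp: minus_CC) (auto simp: ring_of_type_algebra_def)
  then have diff: "\<And>x y. x \<in> K \<Longrightarrow> y \<in> K \<Longrightarrow> x - y \<in> K"
    by (metis diff_conv_add_uminus)
  note defs = quaternion_algebra_def quaternion_mult_def vec_eq_iff forall_4 vector_4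
  show ?thesis
  proof (rule ringI)
    show "abelian_group (quaternion_algebra K a b)"
    proof (rule abelian_groupI)
      fix x assume "x \<in> carrier (quaternion_algebra K a b)"
      then show "\<exists>y\<in>carrier (quaternion_algebra K a b).
          y \<oplus>\<^bsub>quaternion_algebra K a b\<^esub> x = \<zero>\<^bsub>quaternion_algebra K a b\<^esub>"
        by (intro bexI[of _ "- x"]) (auto simp: defs closed)
    qed (auto simp: defs closed algebra_simps)
    show "monoid (quaternion_algebra K a b)"
    proof (rule monoidI)
      fix x y z
      show "x \<otimes>\<^bsub>quaternion_algebra K a b\<^esub> y \<otimes>\<^bsub>quaternion_algebra K a b\<^esub> z =
          x \<otimes>\<^bsub>quaternion_algebra K a b\<^esub> (y \<otimes>\<^bsub>quaternion_algebra K a b\<^esub> z)"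
        unfolding defs by (simp only: ring_record_simps monoid.simps vector_4) (simp add: algebra_simps)
    qed (auto simp: defs closed diff ab)
  qed (auto simp: defs algebra_simps)
qed

lemma reduced_norm_mult:
  "reduced_norm a b (quaternion_mult a b x y) = reduced_norm a b x * reduced_norm a b y"
  unfolding reduced_norm_def quaternion_mult_def vector_4 by (simp add: power2_eq_square algebra_simps)


section \<open>Arithmetic Kleinian groups\<close>

text \<open>The embedding \<open>\<sigma>\<close> of \<open>k\<close> induced by \<open>\<rho>\<close> is the one of the complex place: at a
  real place \<open>P\<rho>(\<O>\<^sup>1)\<close> would be conjugate into the compact group of rotations and not, in general,
  be discrete.\<close>

definition arithmetic_Kleinian :: "(complex^2^2) set set \<Rightarrow> bool" where
  "arithmetic_Kleinian \<Gamma> \<longleftrightarrow> subgroup \<Gamma> PSL2C \<and>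
     (\<exists>k a b \<sigma> \<rho> \<O>.
        number_field k \<and> card (complex_places k) = 1 \<and>
        a \<in> k - {0} \<and> b \<in> k - {0} \<and>
        (\<forall>\<tau>\<in>real_embeddings k. ramified_at a b \<tau>) \<and>
        \<sigma> \<in> complex_embeddings k \<and> algebra_embedding k a b \<sigma> \<rho> \<and>
        quaternion_order k a b \<O> \<and>
        commensurable PSL2C \<Gamma> (PSL_proj ` \<rho> ` norm_one_group a b \<O>))"

end

theory Submission
  imports "Jordan_Normal_Form.Char_Poly" Defs
begin

text \<open>Let \<open>\<Gamma>\<close> be commensurable with \<open>P\<rho>(\<O>\<^sup>1)\<close>, where \<open>\<O>\<close> is an order of \<open>B = (a, b / k)\<close>.
  Conjugation by \<open>i\<close> is an automorphism of \<open>B\<close> of order 2 and \<open>n i\<O>i\<^sup>-\<^sup>1 \<subseteq> \<O>\<close> for some \<open>n > 0\<close>.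
  As \<open>\<O>/n\<O>\<close> is finite, \<open>\<O>\<^sup>1 \<inter> i\<O>\<^sup>1i\<^sup>-\<^sup>1\<close> has finite index in \<open>\<O>\<^sup>1\<close>. Its image \<open>H\<close> in \<open>PSL(2, \<complex>)\<close> is
  normalized by the class \<open>g\<close> of \<open>\<rho>(i)\<close>, rescaled to determinant 1. Since \<open>i\<^sup>2 = a\<close> is central, \<open>g\<close> has
  order 2, so \<open>\<Gamma>\<^sub>0 = H \<union> gH\<close> is the required group. An involution of determinant 1 fixes a
  point of the hyperbolic space, which lies on the singular locus.\<close>

(* otherwise ambiguous with vec_nth *)
no_notation vec_index (infixl "$" 100)

section \<open>Subgroups of finite index\<close>

text \<open>Finiteness of \<open>\<O>/n\<O>\<close> is proved without an integral basis: for every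
  additive subgroup \<open>A\<close> of a finite-dimensional rational space, elements independent
  modulo \<open>p A\<close> are independent over the rationals, which bounds \<open>A / p A\<close>;
  prime factors of \<open>n\<close> are then treated one at a time. The number \<open>n\<close>
  exists because multiplication by an element of \<open>k\<close> has a rational matrix. Clearing
  the denominators of this matrix makes the element an algebraic integer, and finitely many
  generators of \<open>\<O>\<close> need only one common factor. A further obstacle is that
  \<open>\<O>\<^sup>1\<close> must be closed under inverses. The inverse of a norm one element is
  its conjugate; a pigeonhole argument on the inverse powers modulo \<open>n\<O>\<close> shows that
  it lies in \<open>\<O>\<close>. The embedding \<open>\<rho>\<close> is arbitrary, so traces and
  determinants of its values have to be derived from the relations between \<open>i\<close> and
  \<open>j\<close>.\<close>

lemma finite_index_image: "finite_index G H K \<longleftrightarrow> finite ((\<lambda>x. H #>\<^bsub>G\<^esub> x) ` K)"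
  by (auto simp: finite_index_def RCOSETS_def r_coset_def UNION_singleton_eq_range)

context group
begin

lemma r_coset_eq_iff:
  assumes "subgroup H G" "x \<in> carrier G" "y \<in> carrier G"
  shows "H #> x = H #> y \<longleftrightarrow> x \<otimes> inv y \<in> H"
proof
  interpret subgroup H G by fact
  assume "H #> x = H #> y"
  then show "x \<otimes> inv y \<in> H"
    using rcos_module_imp[OF is_group assms(3)] rcos_self[OF assms(2,1)] by blast
next
  interpret subgroup H G by fact
  assume "x \<otimes> inv y \<in> H"
  then have "x \<in> H #> y"
    using rcos_module_rev[OF is_group] assms by blast
  then show "H #> x = H #> y"
    using repr_independence[OF _ assms(3,1)] by simp
qed

text \<open>The coset of \<open>x\<close> is determined by the value \<open>f x\<close>, so there
  are at most as many cosets as values. The finite indices below come from such labellings: cosets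
  of another group, membership in a set, residue classes of quaternions.\<close>

lemma finite_indexI:
  assumes H: "subgroup H G" and K: "K \<subseteq> carrier G" and fin: "finite (f ` K)"
    and f: "\<And>x y. x \<in> K \<Longrightarrow> y \<in> K \<Longrightarrow> f x = f y \<Longrightarrow> x \<otimes> inv y \<in> H"
  shows "finite_index G H K"
proof -
  have "H #> x = H #> inv_into K f (f x)" if "x \<in> K" for x
  proof -
    have "inv_into K f (f x) \<in> K" "f (inv_into K f (f x)) = f x"
      using that by (auto simp: inv_into_into f_inv_into_f)
    then show ?thesis
      using f[OF that] that K by (subst r_coset_eq_iff[OF H]) auto
  qed
  then have "(\<lambda>x. H #> x) ` K = (\<lambda>c. H #> inv_into K f c) ` f ` K"
    by (auto simp: image_image)
  then show ?thesis
    using fin by (simp add: finite_index_image)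
qed

text \<open>Two elements of \<open>L\<close> in the same coset of \<open>H\<close> differ by an
  element of \<open>L\<close>, hence lie in the same coset of \<open>L \<inter> H\<close>.\<close>

lemma finite_index_inter:
  assumes "finite_index G H K" "subgroup H G" "subgroup K G" "subgroup L G"
  shows "finite_index G (L \<inter> H) (L \<inter> K)"
proof (rule finite_indexI[where f = "\<lambda>x. H #> x"])
  show "subgroup (L \<inter> H) G"
    using assms by (intro subgroups_Inter_pair)
  show "L \<inter> K \<subseteq> carrier G"
    using assms by (auto dest: subgroup.subset)
  show "finite ((\<lambda>x. H #> x) ` (L \<inter> K))"
    using assms(1) unfolding finite_index_image by (rule finite_subset[rotated]) auto
  fix x y assume xy: "x \<in> L \<inter> K" "y \<in> L \<inter> K" "H #> x = H #> y"
  then have "x \<otimes> inv y \<in> H"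
    using assms(2,4) by (subst (asm) r_coset_eq_iff) (auto dest: subgroup.mem_carrier)
  then show "x \<otimes> inv y \<in> L \<inter> H"
    using xy assms(4) by (auto intro: subgroup.m_closed subgroup.m_inv_closed)
qed

lemma finite_index_mono:
  assumes "finite_index G H L" "H \<subseteq> K" "subgroup H G" "subgroup K G" "subgroup L G"
  shows "finite_index G K L"
proof (rule finite_indexI[where f = "\<lambda>x. H #> x"])
  show "L \<subseteq> carrier G" "finite ((\<lambda>x. H #> x) ` L)"
    using assms by (auto simp: finite_index_image dest: subgroup.subset)
  fix x y assume "x \<in> L" "y \<in> L" "H #> x = H #> y"
  then show "x \<otimes> inv y \<in> K"
    using assms by (subst (asm) r_coset_eq_iff) (auto dest: subgroup.mem_carrier)
qed fact

text \<open>With \<open>r x\<close> a fixed representative of the \<open>K\<close>-coset of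
  \<open>x\<close>, the label of \<open>x\<close> is this coset together with the
  \<open>H\<close>-coset of \<open>x \<otimes> inv (r x)\<close>, an element of
  \<open>K\<close>.\<close>

lemma finite_index_trans:
  assumes HK: "finite_index G H K" and KL: "finite_index G K L"
    and sub: "subgroup H G" "subgroup K G" "subgroup L G"
  shows "finite_index G H L"
proof -
  define r where "r x = inv_into L (\<lambda>x. K #> x) (K #> x)" for x
  have r: "r x \<in> L" "K #> r x = K #> x" if "x \<in> L" for x
    using that f_inv_into_f[of "K #> x" "\<lambda>x. K #> x" L] unfolding r_def by (auto intro: inv_into_into)
  note carr = sub[THEN subgroup.mem_carrier]
  have rK: "x \<otimes> inv (r x) \<in> K" if "x \<in> L" for x
    using r_coset_eq_iff[OF sub(2), of x "r x"] r[OF that] that carr by auto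
  define f where "f x = (K #> x, H #> (x \<otimes> inv (r x)))" for x
  show ?thesis
  proof (rule finite_indexI[where f = f])
    have "f ` L \<subseteq> (\<lambda>x. K #> x) ` L \<times> (\<lambda>x. H #> x) ` K"
      using rK by (auto simp: f_def)
    then show "finite (f ` L)"
      using HK KL unfolding finite_index_image by (meson finite_SigmaI finite_subset)
    fix x y assume xy: "x \<in> L" "y \<in> L" "f x = f y"
    then have eq: "r x = r y" and "H #> (x \<otimes> inv (r x)) = H #> (y \<otimes> inv (r y))"
      by (auto simp: f_def r_def)
    then have "x \<otimes> inv (r x) \<otimes> inv (y \<otimes> inv (r x)) \<in> H"
      using rK[OF xy(1)] rK[OF xy(2)] carr by (subst (asm) r_coset_eq_iff[OF sub(1)]) auto
    moreover have "x \<in> carrier G" "y \<in> carrier G" "r x \<in> carrier G"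
      using xy carr r by auto
    moreover from this have "x \<otimes> inv (r x) \<otimes> inv (y \<otimes> inv (r x)) = x \<otimes> inv y"
      by (metis inv_closed inv_inv inv_mult_group inv_solve_right m_assoc m_closed)
    ultimately show "x \<otimes> inv y \<in> H" by simp
  qed (use sub in \<open>auto dest: subgroup.subset\<close>)
qed

lemma commensurable_trans:
  assumes "commensurable G H K" "commensurable G K L"
    and "subgroup H G" "subgroup K G" "subgroup L G"
  shows "commensurable G H L"
proof -
  \<comment> \<open>One half of commensurability, obtained through the index of
    \<open>A \<inter> (B \<inter> C)\<close> in \<open>A\<close>; it is used in both
    directions.\<close>
  have *: "finite_index G (A \<inter> C) A"
    if "finite_index G (A \<inter> B) A" "finite_index G (B \<inter> C) B" and
      sub: "subgroup A G" "subgroup B G" "subgroup C G" for A B C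
  proof -
    have "finite_index G (A \<inter> (B \<inter> C)) (A \<inter> B)"
      by (rule finite_index_inter[OF that(2) _ sub(2,1)]) (rule subgroups_Inter_pair[OF sub(2,3)])
    then have "finite_index G (A \<inter> (B \<inter> C)) A"
      by (rule finite_index_trans[OF _ that(1)]) (intro subgroups_Inter_pair sub)+
    then show ?thesis
      by (rule finite_index_mono) (use sub in \<open>auto intro!: subgroups_Inter_pair\<close>)
  qed
  have "finite_index G (L \<inter> H) L"
    by (rule *[where B = K]) (use assms in \<open>auto simp: commensurable_def Int_commute\<close>)
  moreover have "finite_index G (H \<inter> L) H"
    by (rule *[where B = K]) (use assms in \<open>auto simp: commensurable_def Int_commute\<close>)
  ultimately show ?thesis
    by (simp add: commensurable_def Int_commute)
qed

section \<open>Commensurable groups and extension by an involution\<close>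

lemma commensurable_if_common_subgroup:
  assumes "finite_index G M H" "finite_index G M K" "M \<subseteq> H" "M \<subseteq> K"
    and "subgroup M G" "subgroup H G" "subgroup K G"
  shows "commensurable G H K"
  unfolding commensurable_def using assms
  by (auto intro: finite_index_mono[of M] subgroups_Inter_pair)

text \<open>As \<open>g\<close> is its own inverse and normalizes \<open>H\<close>, it can be moved
  to the left past elements of \<open>H\<close> at the cost of a conjugation, so products keep the
  form \<open>h\<close> or \<open>g \<otimes> h\<close>.\<close>

lemma involution_extension:
  assumes H: "subgroup H G" and g: "g \<in> carrier G" "g \<otimes> g = \<one>"
    and conj: "\<And>h. h \<in> H \<Longrightarrow> g \<otimes> h \<otimes> g \<in> H"
  shows "subgroup (H \<union> (\<lambda>h. g \<otimes> h) ` H) G" (is "subgroup ?K G")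
    and "finite_index G H (H \<union> (\<lambda>h. g \<otimes> h) ` H)"
proof -
  note carr [simp] = subgroup.mem_carrier[OF H]
  note Hm = subgroup.m_closed[OF H] and Hi = subgroup.m_inv_closed[OF H]
  have ginv: "inv g = g" using g by (simp add: inv_equality)
  have gg: "g \<otimes> (g \<otimes> x) = x" if "x \<in> carrier G" for x
    using that g by (simp flip: m_assoc)
  have swap: "h \<otimes> g = g \<otimes> (g \<otimes> h \<otimes> g)" if "h \<in> H" for h
    using that g by (simp add: m_assoc gg)
  show K: "subgroup ?K G"
  proof (rule subgroupI)
    show "?K \<subseteq> carrier G" using g by auto
    show "?K \<noteq> {}" using subgroup.one_closed[OF H] by blast
  next
    fix x assume "x \<in> ?K"
    then consider "x \<in> H" | h where "h \<in> H" "x = g \<otimes> h" by blast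
    then show "inv x \<in> ?K"
    proof cases
      case 2
      then have "inv x = g \<otimes> (g \<otimes> inv h \<otimes> g)"
        using g swap[OF Hi] by (simp add: inv_mult_group ginv)
      then show ?thesis using conj[OF Hi] 2 by blast
    qed (use Hi in blast)
  next
    fix x y assume "x \<in> ?K" "y \<in> ?K"
    then consider "x \<in> H" "y \<in> H" | h where "h \<in> H" "x = g \<otimes> h" "y \<in> H"
      | h where "x \<in> H" "h \<in> H" "y = g \<otimes> h"
      | h h' where "h \<in> H" "h' \<in> H" "x = g \<otimes> h" "y = g \<otimes> h'" by blast
    then show "x \<otimes> y \<in> ?K"
    proof cases
      case 1
      then show ?thesis using Hm by blast
    next
      case 2
      then have "x \<otimes> y = g \<otimes> (h \<otimes> y)" using g by (simp add: m_assoc)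
      then show ?thesis using Hm[OF 2(1,3)] by blast
    next
      case 3
      then have "x \<otimes> y = g \<otimes> ((g \<otimes> x \<otimes> g) \<otimes> h)" using g by (simp add: m_assoc gg)
      then show ?thesis using Hm[OF conj[OF 3(1)] 3(2)] by blast
    next
      case 4
      then have "x \<otimes> y = (g \<otimes> h \<otimes> g) \<otimes> h'" using g by (simp add: m_assoc)
      then show ?thesis using Hm[OF conj[OF 4(1)] 4(2)] by simp
    qed
  qed
  show "finite_index G H ?K"
  \<comment> \<open>Membership in \<open>H\<close> has two values, so the index is at most 2:
    elements outside \<open>H\<close> have the form \<open>g \<otimes> h\<close>, and two of these
    differ by a conjugate of an element of \<open>H\<close>.\<close>
  proof (rule finite_indexI[where f = "\<lambda>x. x \<in> H"])
    fix x y assume xy: "x \<in> ?K" "y \<in> ?K" "(x \<in> H) = (y \<in> H)"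
    then consider "x \<in> H" "y \<in> H" | h h' where "h \<in> H" "h' \<in> H" "x = g \<otimes> h" "y = g \<otimes> h'"
      by blast
    then show "x \<otimes> inv y \<in> H"
    proof cases
      case 2
      then have "x \<otimes> inv y = g \<otimes> (h \<otimes> inv h') \<otimes> g"
        using g by (simp add: m_assoc inv_mult_group ginv)
      then show ?thesis using conj[OF Hm[OF _ Hi]] 2 by simp
    qed (use Hm Hi in blast)
  qed (use H K subgroup.subset in auto)
qed

lemma ord_eq_2:
  assumes "g \<in> carrier G" "g \<noteq> \<one>" "g \<otimes> g = \<one>"
  shows "ord g = 2"
proof -
  have "g [^] (2::nat) = \<one>" using assms by (simp add: numeral_2_eq_2)
  then have "ord g dvd 2" using pow_eq_id assms(1) by blast
  moreover have "ord g \<noteq> 1" using ord_eq_1 assms by blast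
  ultimately show ?thesis
    using two_is_prime_nat unfolding prime_nat_iff by blast
qed

end

section \<open>Algebraic integers\<close>

interpretation int_span: Modules.module "\<lambda>n x :: complex. of_int n * x"
  by unfold_locales (simp_all add: algebra_simps)

text \<open>The determinant trick: the elements of \<open>V\<close> form an eigenvector, with
  eigenvalue \<open>x\<close>, of an integer matrix, so \<open>x\<close> is a root of its monic
  characteristic polynomial. The element \<open>v\<^sub>0\<close> makes the eigenvector
  non-zero.\<close>

lemma algebraic_int_if_stable:
  assumes V: "finite V" "v\<^sub>0 \<in> V" "v\<^sub>0 \<noteq> 0"
    and stable: "\<And>v. v \<in> V \<Longrightarrow> x * v \<in> int_span.span V"
  shows "algebraic_int x"
proof -
  obtain vs where vs: "set vs = V" "distinct vs"
    using finite_distinct_list[OF V(1)] by blast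
  define n where "n = length vs"
  have "\<exists>c. x * v = (\<Sum>w\<in>V. of_int (c w) * w)" if "v \<in> V" for v
    using stable[OF that] unfolding int_span.span_finite[OF V(1)] by auto
  then obtain c where c: "\<And>v. v \<in> V \<Longrightarrow> x * v = (\<Sum>w\<in>V. of_int (c v w) * w)"
    by metis
  define M where "M = Matrix.mat n n (\<lambda>(i, j). c (vs ! i) (vs ! j))"
  have M: "M \<in> carrier_mat n n" by (simp add: M_def)
  then have M': "map_mat complex_of_int M \<in> carrier_mat n n" by simp
  have eq: "map_mat of_int M *\<^sub>v vec_of_list vs = x \<cdot>\<^sub>v vec_of_list vs"
  proof (intro eq_vecI)
    fix i assume "i < dim_vec (x \<cdot>\<^sub>v vec_of_list vs)"
    then have i: "i < n" by (simp add: n_def)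
    then have "x * vs ! i = (\<Sum>w\<in>V. of_int (c (vs ! i) w) * w)"
      by (intro c) (use vs n_def in auto)
    also have "\<dots> = (\<Sum>j<n. of_int (c (vs ! i) (vs ! j)) * vs ! j)"
      using bij_betw_nth[OF vs(2) refl refl]
      by (intro sum.reindex_bij_betw[symmetric]) (simp add: vs n_def)
    finally show "vec_index (map_mat of_int M *\<^sub>v vec_of_list vs) i = vec_index (x \<cdot>\<^sub>v vec_of_list vs) i"
      using i by (simp add: M_def scalar_prod_def n_def atLeast0LessThan vec_of_list_index)
  qed (simp add: M_def n_def)
  have "vec_of_list vs \<in> carrier_vec (dim_row (map_mat complex_of_int M))"
    by (rule carrier_vecI) (simp add: M_def n_def)
  moreover have "vec_of_list vs \<noteq> 0\<^sub>v (dim_row (map_mat complex_of_int M))"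
  proof -
    have "dim_row (map_mat complex_of_int M) = n" by (simp add: M_def)
    then show ?thesis
      using V(2,3) vs by (metis in_set_conv_nth index_zero_vec(1) n_def vec_of_list_index)
  qed
  ultimately have "eigenvector (map_mat of_int M) (vec_of_list vs) x"
    unfolding eigenvector_def using eq by blast
  then have "eigenvalue (map_mat of_int M) x"
    unfolding eigenvalue_def by (rule exI)
  then have "poly (char_poly (map_mat complex_of_int M)) x = 0"
    using eigenvalue_root_char_poly[OF M'] by simp
  then have "poly (map_poly of_int (char_poly M)) x = 0"
    by (simp add: of_int_hom.char_poly_hom[OF M])
  moreover have "Polynomial.lead_coeff (char_poly M) = 1"
    using degree_monic_char_poly[OF M] by simp
  ultimately show ?thesis
    by (auto simp: algebraic_int_altdef_ipoly)
qed

lemma int_span_mult: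
  assumes "x \<in> int_span.span V" "y \<in> int_span.span W"
  shows "x * y \<in> int_span.span {v * w |v w. v \<in> V \<and> w \<in> W}"
proof -
  let ?S = "int_span.span {v * w |v w. v \<in> V \<and> w \<in> W}"
  have *: "v * y \<in> ?S" if "v \<in> V" for v
    using assms(2)
  proof (induction rule: int_span.span_induct_alt)
    case (step c w z)
    have "of_int c * (v * w) \<in> ?S"
      using step that by (intro int_span.span_scale int_span.span_base) auto
    from int_span.span_add[OF this step(2)] show ?case by (simp add: algebra_simps)
  qed (simp add: int_span.span_zero)
  show ?thesis
    using assms(1)
  proof (induction rule: int_span.span_induct_alt)
    case (step c v z)
    have "of_int c * (v * y) \<in> ?S"
      using step * by (intro int_span.span_scale) auto
    from int_span.span_add[OF this step(2)] show ?case by (simp add: algebra_simps)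
  qed (simp add: int_span.span_zero)
qed

text \<open>Converse of the determinant trick: the powers of \<open>x\<close> below the degree of a
  monic equation span a group stable under \<open>x\<close>.\<close>

lemma algebraic_int_imp_stable:
  fixes x :: complex
  assumes "algebraic_int x"
  shows "\<exists>V. finite V \<and> 1 \<in> V \<and> (\<forall>v\<in>V. x * v \<in> int_span.span V)"
proof -
  obtain p where p: "poly (map_poly of_int p) x = 0" "Polynomial.lead_coeff p = 1"
    using assms by (auto simp: algebraic_int_altdef_ipoly)
  define n where "n = Polynomial.degree p"
  \<comment> \<open>A constant monic polynomial is 1 and has no root. This ensures that
    \<open>x ^ 0\<close> occurs in \<open>V\<close>.\<close>
  have "n \<noteq> 0"
  proof
    assume "n = 0"
    then obtain c where "p = [:c:]" unfolding n_def by (rule degree_eq_zeroE)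
    with p show False by simp
  qed
  define V where "V = (\<lambda>i. x ^ i) ` {..<n}"
  have "x * v \<in> int_span.span V" if v: "v \<in> V" for v
  proof -
    obtain i where i: "i < n" "v = x ^ i" using v by (auto simp: V_def)
    show ?thesis
    proof (cases "Suc i = n")
      case False
      then have "x * v = x ^ Suc i" "Suc i < n" using i by auto
      then show ?thesis by (metis V_def imageI int_span.span_base lessThan_iff)
    next
      case True
      have "0 = (\<Sum>j\<le>n. of_int (Polynomial.coeff p j) * x ^ j)"
        using p by (simp add: poly_altdef n_def degree_map_poly coeff_map_poly)
      also have "\<dots> = x ^ n + (\<Sum>j<n. of_int (Polynomial.coeff p j) * x ^ j)"
        using p by (simp add: n_def flip: lessThan_Suc_atMost)
      finally have "x * v = - (\<Sum>j<n. of_int (Polynomial.coeff p j) * x ^ j)"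
        using i True by (simp add: eq_neg_iff_add_eq_0 flip: power_Suc)
      also have "\<dots> \<in> int_span.span V"
        by (intro int_span.span_neg int_span.span_sum int_span.span_scale int_span.span_base)
           (auto simp: V_def)
      finally show ?thesis .
    qed
  qed
  moreover have "finite V" "1 \<in> V"
    using \<open>n \<noteq> 0\<close> by (auto simp: V_def intro!: image_eqI[of _ _ 0])
  ultimately show ?thesis by blast
qed

text \<open>The pairwise products of two stable sets form a set stable under \<open>x * y\<close>.
  Closure under products is what lets the integers of \<open>k\<close> act on an order.\<close>

lemma algebraic_int_mult:
  fixes x y :: complex
  assumes "algebraic_int x" "algebraic_int y"
  shows "algebraic_int (x * y)"
proof -
  obtain V where V: "finite V" "1 \<in> V" "\<And>v. v \<in> V \<Longrightarrow> x * v \<in> int_span.span V"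
    using algebraic_int_imp_stable[OF assms(1)] by blast
  obtain W where W: "finite W" "1 \<in> W" "\<And>w. w \<in> W \<Longrightarrow> y * w \<in> int_span.span W"
    using algebraic_int_imp_stable[OF assms(2)] by blast
  let ?U = "{v * w |v w. v \<in> V \<and> w \<in> W}"
  show ?thesis
  proof (rule algebraic_int_if_stable)
    show "finite ?U" using V W by (intro finite_image_set2) auto
    show "1 \<in> ?U" using V W by force
    show "x * y * u \<in> int_span.span ?U" if u: "u \<in> ?U" for u
    proof -
      obtain v w where "u = v * w" "v \<in> V" "w \<in> W" using u by blast
      then have "(x * v) * (y * w) \<in> int_span.span ?U"
        using V W by (intro int_span_mult)
      then show ?thesis using \<open>u = v * w\<close> by (simp add: mult_ac)
    qed
  qed simp
qed

section \<open>Finite quotients of subgroups of rational vector spaces\<close>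

lemma common_denominator:
  fixes u :: "'a \<Rightarrow> rat"
  assumes "finite S"
  obtains D :: nat and c where "D > 0" "\<And>s. s \<in> S \<Longrightarrow> of_nat D * u s = of_int (c s)"
proof -
  have "\<exists>D::nat. D > 0 \<and> (\<forall>s\<in>S. of_nat D * u s \<in> \<int>)"
    using assms
  proof induction
    case (insert a S)
    then obtain D :: nat where D: "D > 0" "\<And>s. s \<in> S \<Longrightarrow> of_nat D * u s \<in> \<int>" by blast
    obtain m n where mn: "quotient_of (u a) = (m, n)" by fastforce
    then have n: "n > 0" "u a = of_int m / of_int n"
      using quotient_of_denom_pos quotient_of_div by auto
    then have nn: "rat_of_nat (nat n) = of_int n" by (intro of_nat_nat) simp
    show ?case
    proof (intro exI[of _ "nat n * D"] conjI ballI)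
      fix s assume "s \<in> insert a S"
      then show "of_nat (nat n * D) * u s \<in> \<int>"
      proof
        assume "s \<in> S"
        then have "of_int n * (of_nat D * u s) \<in> \<int>" using D(2) by (meson Ints_mult Ints_of_int)
        moreover have "of_nat (nat n * D) * u s = of_int n * (of_nat D * u s)" by (simp only: of_nat_mult nn mult.assoc)
        ultimately show ?thesis by (simp only:)
      next
        assume "s = a"
        then have "of_nat (nat n * D) * u s = of_int (int D * m)" using n by (simp add: nn)
        then show ?thesis by (metis Ints_of_int)
      qed
    qed (use n D in simp)
  qed (auto intro: exI[of _ 1])
  then obtain D :: nat where "D > 0" "\<And>s. s \<in> S \<Longrightarrow> of_nat D * u s \<in> \<int>" by blast
  then show ?thesis
    by (intro that[of D "\<lambda>s. \<lfloor>of_nat D * u s\<rfloor>"]) simp_all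
qed

text \<open>\<open>A\<close> will be the order itself, inside the rational vector space of
  coordinate vectors. It is any additive subgroup; no finite set of generators over the integers is
  given.\<close>

locale rat_subgroup = vector_space scale
  for scale :: "rat \<Rightarrow> 'v::ab_group_add \<Rightarrow> 'v" +
  fixes A :: "'v set"
  assumes zero: "0 \<in> A" and diff: "\<And>x y. x \<in> A \<Longrightarrow> y \<in> A \<Longrightarrow> x - y \<in> A"
begin

lemma add: "x \<in> A \<Longrightarrow> y \<in> A \<Longrightarrow> x + y \<in> A"
  using diff[of x "0 - y"] diff[OF zero, of y] by simp

lemma scale_int: "x \<in> A \<Longrightarrow> scale (of_int c) x \<in> A"
proof (induction c rule: int_induct[where k = 0])
  case (step1 i)
  then show ?case using add[of _ x] by (simp add: scale_left_distrib)
next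
  case (step2 i)
  then show ?case using diff[of _ x] by (simp add: scale_left_diff_distrib)
qed (simp add: zero)

lemma sum_mem: "(\<And>t. t \<in> T \<Longrightarrow> f t \<in> A) \<Longrightarrow> sum f T \<in> A"
  by (induction T rule: infinite_finite_induct) (auto simp: zero add)

definition multiples :: "nat \<Rightarrow> 'v set" where
  "multiples n = scale (of_nat n) ` A"

text \<open>For prime \<open>p\<close> and \<open>T\<close> inside \<open>A\<close>: linear
  independence of the classes of \<open>T\<close> in \<open>A / p A\<close> over the field with
  \<open>p\<close> elements.\<close>

definition indep_mod :: "nat \<Rightarrow> 'v set \<Rightarrow> bool" where
  "indep_mod p T \<longleftrightarrow> (\<forall>c. (\<Sum>t\<in>T. scale (of_int (c t)) t) \<in> multiples p \<longrightarrow> (\<forall>t\<in>T. int p dvd c t))"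

lemma multiples_int: "x \<in> A \<Longrightarrow> scale (of_int (int p * c)) x \<in> multiples p"
  unfolding multiples_def using scale_int[of x c] by (intro image_eqI[of _ _ "scale (of_int c) x"]) (auto simp: scale_scale)

lemma multiples_subgroup: "0 \<in> multiples p" "\<And>x y. x \<in> multiples p \<Longrightarrow> y \<in> multiples p \<Longrightarrow> x - y \<in> multiples p"
  unfolding multiples_def using zero diff by (auto simp flip: scale_right_diff_distrib intro: image_eqI[of _ _ 0])

text \<open>A non-trivial rational relation yields an integral one, whose coefficients would be divisible by
  arbitrarily high powers of \<open>p\<close>.\<close>

lemma independent_if_indep_mod:
  assumes T: "finite T" "indep_mod p T" and p: "p > 1"
  shows "independent T"
proof
  assume "dependent T"
  then obtain u v where u: "(\<Sum>t\<in>T. scale (u t) t) = 0" "v \<in> T" "u v \<noteq> 0"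
    using dependent_finite[OF T(1)] by auto
  obtain D :: nat and c where D: "D > 0" "\<And>t. t \<in> T \<Longrightarrow> of_nat D * u t = of_int (c t)"
    using common_denominator[OF T(1), of u] by metis
  have "(\<Sum>t\<in>T. scale (of_int (c t)) t) = scale (of_nat D) (\<Sum>t\<in>T. scale (u t) t)"
    unfolding scale_sum_right by (intro sum.cong refl) (simp add: scale_scale D)
  then have c: "(\<Sum>t\<in>T. scale (of_int (c t)) t) = 0"
    by (simp add: u)
  \<comment> \<open>The induction lets \<open>c\<close> vary: once all coefficients are divisible by
    \<open>p\<close>, the relation can be divided by \<open>p\<close> in a rational space, and the
    quotients again form a relation.\<close>
  have pow: "\<forall>t\<in>T. int p ^ m dvd c t" if "(\<Sum>t\<in>T. scale (of_int (c t)) t) = 0" for c m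
    using that
  proof (induction m arbitrary: c)
    case (Suc m)
    have "\<forall>t\<in>T. int p dvd c t"
      using T(2) Suc(2) multiples_subgroup(1)[of p] unfolding indep_mod_def by metis
    then obtain d where d: "\<And>t. t \<in> T \<Longrightarrow> c t = int p * d t"
      unfolding dvd_def by metis
    have "scale (of_nat p) (\<Sum>t\<in>T. scale (of_int (d t)) t) = (\<Sum>t\<in>T. scale (of_int (c t)) t)"
      unfolding scale_sum_right by (intro sum.cong refl) (simp add: d scale_scale)
    then have "(\<Sum>t\<in>T. scale (of_int (d t)) t) = 0"
      using Suc(2) p by simp
    from Suc(1)[OF this] show ?case by (simp add: d)
  qed simp
  have "c v = 0"
  proof (rule ccontr)
    assume "c v \<noteq> 0"
    \<comment> \<open>The absolute value of \<open>c v\<close> serves as exponent because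
      \<open>m < p ^ m\<close>, while a divisor of a non-zero integer cannot exceed its absolute
      value.\<close>
    have "int p ^ nat \<bar>c v\<bar> dvd c v" using pow[OF c] u by blast
    then have "int p ^ nat \<bar>c v\<bar> \<le> \<bar>c v\<bar>"
      using \<open>c v \<noteq> 0\<close> by (metis abs_ge_zero dvd_abs_iff dvd_imp_le_int abs_of_nat of_nat_power)
    moreover have "nat \<bar>c v\<bar> < p ^ nat \<bar>c v\<bar>"
      using p by (simp add: power_gt_expt)
    then have "int (nat \<bar>c v\<bar>) < int (p ^ nat \<bar>c v\<bar>)"
      unfolding of_nat_less_iff .
    ultimately show False by simp
  qed
  then show False using D(1) D(2)[OF u(2)] u(3) by simp
qed

text \<open>A largest set \<open>T\<close> independent modulo \<open>p\<close> exists because it is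
  also independent over the rationals, which bounds its size by \<open>card B\<close>. By maximality
  \<open>T\<close> spans \<open>A\<close> modulo \<open>p\<close>, and there coefficients matter
  only modulo \<open>p\<close>.\<close>

lemma finite_quotient_prime:
  assumes fin: "finite B" "A \<subseteq> span B" and p: "Factorial_Ring.prime p"
  shows "\<exists>F. finite F \<and> F \<subseteq> A \<and> (\<forall>a\<in>A. \<exists>f\<in>F. a - f \<in> multiples p)"
proof -
  have p1: "p > 1" using p by (rule prime_gt_1_nat)
  define P where "P T \<longleftrightarrow> finite T \<and> T \<subseteq> A \<and> indep_mod p T" for T
  have "card T \<le> card B" if "P T" for T
  proof -
    have "finite T" "indep_mod p T" "T \<subseteq> span B" using that fin(2) by (auto simp: P_def)
    then show ?thesis
      using independent_span_bound[OF fin(1) independent_if_indep_mod[OF _ _ p1]] by blast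
  qed
  moreover have "P {}" by (simp add: P_def indep_mod_def)
  ultimately have "\<exists>T. P T \<and> (\<forall>T'. P T' \<longrightarrow> card T' \<le> card T)"
    by (intro ex_has_greatest_nat[of P "{}" card "Suc (card B)"]) (simp_all add: less_Suc_eq_le)
  then obtain T where T: "P T" "\<And>T'. P T' \<Longrightarrow> card T' \<le> card T"
    by blast
  then have T': "finite T" "T \<subseteq> A" "indep_mod p T" by (auto simp: P_def)
  let ?L = "\<lambda>c. \<Sum>t\<in>T. scale (of_int (c t)) t"
  have L: "?L c \<in> A" for c
    using T' by (intro sum_mem scale_int) auto
  have ex: "\<exists>c. a - ?L c \<in> multiples p" if a: "a \<in> A" for a
  proof (cases "a \<in> T")
    case True
    \<comment> \<open>For \<open>a\<close> in \<open>T\<close>, adjoining \<open>a\<close> gives no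
      larger set to contradict maximality, but \<open>a\<close> is trivially a combination of
      \<open>T\<close>.\<close>
    have "?L (\<lambda>t. if t = a then 1 else 0) = (\<Sum>t\<in>T. if t = a then a else 0)"
      by (intro sum.cong) auto
    then have "a - ?L (\<lambda>t. if t = a then 1 else 0) = 0"
      using T' True by simp
    then show ?thesis using multiples_subgroup(1) by metis
  next
    case False
    then have "\<not> indep_mod p (insert a T)"
      using T(2)[of "insert a T"] T' a by (auto simp: P_def)
    then obtain c t where c: "scale (of_int (c a)) a + ?L c \<in> multiples p"
      and t: "t \<in> insert a T" "\<not> int p dvd c t"
      using T' False unfolding indep_mod_def by auto
    \<comment> \<open>Otherwise the term at \<open>a\<close> could be removed modulo
      \<open>p\<close>, and what remains would contradict the independence of
      \<open>T\<close>.\<close>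
    have "\<not> int p dvd c a"
    proof
      assume pa: "int p dvd c a"
      then have "scale (of_int (c a)) a \<in> multiples p"
        using multiples_int[OF a] by (auto elim!: dvdE)
      from multiples_subgroup(2)[OF c this] have "?L c \<in> multiples p" by simp
      then show False using T'(3) t pa unfolding indep_mod_def by auto
    qed
    then have "coprime (c a) (int p)"
      using p by (simp add: coprime_commute prime_imp_coprime)
    \<comment> \<open>Bezout makes \<open>u\<close> an inverse of \<open>c a\<close> modulo
      \<open>p\<close>; multiplying the relation by \<open>u\<close> solves it for
      \<open>a\<close>.\<close>
    then obtain u v where "u * c a + v * int p = 1"
      using bezout_int[of "c a" "int p"] by (auto simp: coprime_iff_gcd_eq_1)
    then obtain w where w: "c a * u = 1 + int p * w"
      by (intro that[of "- v"]) (simp add: algebra_simps)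
    obtain x where x: "x \<in> A" "scale (of_int (c a)) a + ?L c = scale (of_nat p) x"
      using c by (auto simp: multiples_def)
    have "?L (\<lambda>t. - u * c t) = scale (- of_int u) (?L c)"
      unfolding scale_sum_right by (intro sum.cong refl) (simp add: scale_scale)
    also have "\<dots> = scale (- of_int u) (scale (of_nat p) x - scale (of_int (c a)) a)"
      using x(2) by (simp add: eq_diff_eq add.commute)
    also have "\<dots> = scale (of_int (c a * u)) a - scale (of_nat p) (scale (of_int u) x)"
      by (simp add: scale_right_diff_distrib scale_scale mult.commute scale_minus_left)
    also have "\<dots> = a - scale (of_nat p) (scale (of_int u) x - scale (of_int w) a)"
      unfolding w by (simp add: scale_right_diff_distrib scale_left_distrib scale_scale algebra_simps)
    finally have "a - ?L (\<lambda>t. - u * c t) = scale (of_nat p) (scale (of_int u) x - scale (of_int w) a)"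
      by simp
    then have "a - ?L (\<lambda>t. - u * c t) \<in> multiples p"
      unfolding multiples_def by (rule image_eqI) (intro diff scale_int x a)
    then show ?thesis by (intro exI[of _ "\<lambda>t. - u * c t"])
  qed
  define F where "F = ?L ` (PiE T (\<lambda>_. {0..<int p}))"
  have "finite F" unfolding F_def using T' by (intro finite_imageI finite_PiE) auto
  moreover have "F \<subseteq> A" using L by (auto simp: F_def)
  moreover have "\<exists>f\<in>F. a - f \<in> multiples p" if a: "a \<in> A" for a
  proof -
    obtain c where c: "a - ?L c \<in> multiples p" using ex[OF a] by blast
    \<comment> \<open>The restriction makes \<open>d\<close> extensional, as membership in the
      finite set \<open>PiE\<close> demands.\<close>
    define d where "d = restrict (\<lambda>t. c t mod int p) T"
    have "?L c - ?L d = scale (of_nat p) (?L (\<lambda>t. c t div int p))"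
      unfolding scale_sum_right sum_subtractf[symmetric]
    proof (intro sum.cong refl)
      fix t assume "t \<in> T"
      have "of_int (c t) - of_int (c t mod int p) = (of_nat p * of_int (c t div int p) :: rat)"
        by (metis add_diff_cancel_right' mult_div_mod_eq of_int_add of_int_mult of_int_of_nat_eq)
      then show "scale (of_int (c t)) t - scale (of_int (d t)) t
          = scale (of_nat p) (scale (of_int (c t div int p)) t)"
        using \<open>t \<in> T\<close> by (simp add: d_def scale_scale flip: scale_left_diff_distrib)
    qed
    then have "?L c - ?L d \<in> multiples p"
      unfolding multiples_def by (rule image_eqI) (rule L)
    from multiples_subgroup(2)[OF multiples_subgroup(1) this] have "?L d - ?L c \<in> multiples p"
      by simp
    from multiples_subgroup(2)[OF c this] have "a - ?L d \<in> multiples p" by simp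
    moreover have "?L d \<in> F"
      unfolding F_def by (rule imageI) (use p1 in \<open>auto simp: d_def\<close>)
    ultimately show ?thesis by blast
  qed
  ultimately show ?thesis by blast
qed

text \<open>Induction on the prime factorization: \<open>a = e + p x\<close> and
  \<open>x = f + n y\<close> give \<open>a = (e + p f) + (p n) y\<close>. In the unit case the
  modulus is 1 and 0 represents everything.\<close>

lemma finite_quotient:
  assumes fin: "finite B" "A \<subseteq> span B" and n: "n > 0"
  shows "\<exists>F. finite F \<and> F \<subseteq> A \<and> (\<forall>a\<in>A. \<exists>f\<in>F. a - f \<in> multiples n)"
  using n
proof (induction n rule: prime_divisors_induct)
  case (unit x)
  then show ?case using zero by (intro exI[of _ "{0}"]) (auto simp: multiples_def)
next
  case (factor p n)
  then obtain F where F: "finite F" "F \<subseteq> A" "\<And>a. a \<in> A \<Longrightarrow> \<exists>f\<in>F. a - f \<in> multiples n"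
    by auto
  obtain E where E: "finite E" "E \<subseteq> A" "\<And>a. a \<in> A \<Longrightarrow> \<exists>e\<in>E. a - e \<in> multiples p"
    using finite_quotient_prime[OF fin factor(1)] by auto
  show ?case
  proof (intro exI[of _ "(\<lambda>(e, f). e + scale (of_nat p) f) ` (E \<times> F)"] conjI ballI)
    show "(\<lambda>(e, f). e + scale (of_nat p) f) ` (E \<times> F) \<subseteq> A"
    proof clarsimp
      fix e f assume "e \<in> E" "f \<in> F"
      then have "scale (of_int (int p)) f \<in> A" "e \<in> A" using E F by (auto intro: scale_int simp del: of_int_of_nat_eq)
      then show "e + scale (of_nat p) f \<in> A" by (simp add: add)
    qed
    fix a assume "a \<in> A"
    then obtain e x where e: "e \<in> E" "a - e = scale (of_nat p) x" "x \<in> A"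
      using E(3) unfolding multiples_def by blast
    obtain f y where f: "f \<in> F" "x - f = scale (of_nat n) y" "y \<in> A"
      using F(3)[OF e(3)] unfolding multiples_def by blast
    have "a - (e + scale (of_nat p) f) = scale (of_nat p) (x - f)"
      using e(2) by (simp add: scale_right_diff_distrib algebra_simps)
    also have "\<dots> = scale (of_nat (p * n)) y"
      by (simp add: f scale_scale)
    finally show "\<exists>f\<in>(\<lambda>(e, f). e + scale (of_nat p) f) ` (E \<times> F). a - f \<in> multiples (p * n)"
      using e f by (intro bexI[of _ "e + scale (of_nat p) f"]) (auto simp: multiples_def)
  qed (use E F in simp)
qed simp

end

section \<open>Number fields\<close>

interpretation rat_span: vector_space "\<lambda>q x :: complex. of_rat q * x"
  by unfold_locales (simp_all add: algebra_simps of_rat_add of_rat_mult)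

interpretation rat_span4: vector_space "\<lambda>q x :: complex^4. of_rat q *s x"
  by unfold_locales
     (simp_all add: vector_add_ldistrib vector_sadd_rdistrib vector_smult_assoc of_rat_add of_rat_mult)

lemma subfield_CC_closed:
  assumes "subfield k CC"
  shows "0 \<in> k" "1 \<in> k" "\<And>x y. x \<in> k \<Longrightarrow> y \<in> k \<Longrightarrow> x + y \<in> k"
    "\<And>x y. x \<in> k \<Longrightarrow> y \<in> k \<Longrightarrow> x * y \<in> k" "\<And>x. x \<in> k \<Longrightarrow> - x \<in> k"
    "\<And>x y. x \<in> k \<Longrightarrow> y \<in> k \<Longrightarrow> x - y \<in> k" "subring k CC"
proof -
  interpret CC: ring CC by (rule ring_from_type_algebra)
  have minus_CC: "\<ominus>\<^bsub>CC\<^esub> x = - x" for x :: complex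
    by (rule CC.minus_equality) (simp_all add: ring_of_type_algebra_def)
  show K: "subring k CC"
    using assms by (simp add: subfield_def subdomain_def subcring_def)
  show closed: "0 \<in> k" "1 \<in> k" "\<And>x y. x \<in> k \<Longrightarrow> y \<in> k \<Longrightarrow> x + y \<in> k"
    "\<And>x y. x \<in> k \<Longrightarrow> y \<in> k \<Longrightarrow> x * y \<in> k" "\<And>x. x \<in> k \<Longrightarrow> - x \<in> k"
    using subringE(2,3,5-7)[OF K] unfolding minus_CC by (simp_all add: ring_of_type_algebra_def)
  show "x - y \<in> k" if "x \<in> k" "y \<in> k" for x y
    using closed(3)[OF that(1) closed(5)[OF that(2)]] by simp
qed

text \<open>Each step of the inductive definition of dimension adjoins one vector, which becomes one
  more spanning element in the sense of \<open>vector_space\<close>.\<close>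

lemma number_field_span:
  assumes "number_field k"
  shows "\<exists>B. finite B \<and> rat_span.span B = k"
proof -
  interpret CC: ring CC by (rule ring_from_type_algebra)
  obtain n where "CC.dimension n \<rat> k"
    using assms by (auto simp: number_field_def CC.finite_dimension_def)
  then show ?thesis
  proof (induction n "\<rat> :: complex set" k rule: CC.dimension.induct)
    case zero_dim
    show ?case by (intro exI[of _ "{}"]) (simp add: ring_of_type_algebra_def)
  next
    case (Suc_dim v E n)
    then obtain B where B: "finite B" "rat_span.span B = E" by blast
    have "rat_span.span (insert v B) = CC.line_extension \<rat> v E"
    proof (intro equalityI subsetI)
      fix x assume "x \<in> rat_span.span (insert v B)"
      then obtain q where "x - of_rat q * v \<in> E"
        using rat_span.span_insert[of v B] B by auto
      then show "x \<in> CC.line_extension \<rat> v E"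
        unfolding CC.line_extension_mem_iff
        by (intro bexI[of _ "of_rat q"] bexI[of _ "x - of_rat q * v"])
           (simp_all add: ring_of_type_algebra_def)
    next
      fix x assume "x \<in> CC.line_extension \<rat> v E"
      then obtain q e where "e \<in> E" "x = of_rat q * v + e"
        unfolding CC.line_extension_mem_iff by (auto simp: ring_of_type_algebra_def Rats_def)
      then show "x \<in> rat_span.span (insert v B)"
        unfolding rat_span.span_insert B by (intro CollectI exI[of _ q]) simp
    qed
    then show ?case using B by (intro exI[of _ "insert v B"]) simp
  qed
qed

text \<open>Multiplication by \<open>x\<close> has a rational matrix with respect to a finite
  spanning set of \<open>k\<close>. With \<open>n\<close> a common denominator of the entries,
  \<open>n x\<close> maps the integral span into itself and the determinant trick applies.\<close>

lemma number_field_denominator: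
  assumes k: "number_field k" "x \<in> k"
  shows "\<exists>n::nat. n > 0 \<and> algebraic_int (of_nat n * x)"
proof -
  note closed = subfield_CC_closed[OF k(1)[unfolded number_field_def, THEN conjunct1]]
  obtain B where B: "finite B" "rat_span.span B = k"
    using number_field_span[OF k(1)] by blast
  have "\<exists>q. x * b = (\<Sum>b'\<in>B. of_rat (q b') * b')" if "b \<in> B" for b
  proof -
    have "x * b \<in> rat_span.span B"
      using closed(4)[OF k(2)] that B(2) rat_span.span_base[of b B] by blast
    then show ?thesis unfolding rat_span.span_finite[OF B(1)] by auto
  qed
  then obtain q where q: "\<And>b. b \<in> B \<Longrightarrow> x * b = (\<Sum>b'\<in>B. of_rat (q b b') * b')"
    by metis
  obtain n :: nat and c where n: "n > 0"
    and c: "\<And>s. s \<in> B \<times> B \<Longrightarrow> of_nat n * (case s of (b, b') \<Rightarrow> q b b') = of_int (c s)"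
    using common_denominator[of "B \<times> B" "\<lambda>(b, b'). q b b'"] B(1) by (metis finite_cartesian_product)
  have "\<exists>b\<in>B. b \<noteq> 0"
  proof (rule ccontr)
    assume "\<not> ?thesis"
    then have "rat_span.span B \<subseteq> {0}"
      by (intro rat_span.span_minimal) (auto simp: rat_span.subspace_def)
    then show False using B closed(2) by auto
  qed
  then obtain b\<^sub>0 where b\<^sub>0: "b\<^sub>0 \<in> B" "b\<^sub>0 \<noteq> 0" by blast
  have "algebraic_int (of_nat n * x)"
  proof (rule algebraic_int_if_stable[OF B(1) b\<^sub>0])
    fix b assume b: "b \<in> B"
    have "of_nat n * x * b = (\<Sum>b'\<in>B. of_int (c (b, b')) * b')"
      unfolding mult.assoc q[OF b] sum_distrib_left
    proof (intro sum.cong refl)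
      fix b' assume "b' \<in> B"
      have "of_nat n * of_rat (q b b') = of_rat (of_nat n * q b b')"
        by (simp add: of_rat_mult)
      also have "\<dots> = (of_int (c (b, b')) :: complex)"
        using c[of "(b, b')"] b \<open>b' \<in> B\<close> by simp
      finally show "of_nat n * (of_rat (q b b') * b') = of_int (c (b, b')) * b'"
        by (simp flip: mult.assoc)
    qed
    also have "\<dots> \<in> int_span.span B"
      by (intro int_span.span_sum int_span.span_scale int_span.span_base)
    finally show "of_nat n * x * b \<in> int_span.span B" .
  qed
  with n show ?thesis by blast
qed

text \<open>Since coordinates lie in \<open>k\<close>, the group \<open>A\<close> is contained in
  the rational span of the finitely many vectors \<open>axis i b\<close>, with \<open>b\<close> in a
  rational spanning set of \<open>k\<close>.\<close>

lemma finite_quotient_vec4: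
  fixes A :: "(complex^4) set" and n :: nat
  assumes k: "number_field k" and A: "0 \<in> A" "\<And>x y. x \<in> A \<Longrightarrow> y \<in> A \<Longrightarrow> x - y \<in> A"
    "\<And>x i. x \<in> A \<Longrightarrow> x $ i \<in> k" and n: "n > 0"
  shows "\<exists>F. finite F \<and> F \<subseteq> A \<and> (\<forall>a\<in>A. \<exists>f\<in>F. \<exists>b\<in>A. a - f = of_nat n *s b)"
proof -
  interpret rat_subgroup "\<lambda>q x :: complex^4. of_rat q *s x" A
    by unfold_locales (use A in auto)
  obtain B where B: "finite B" "rat_span.span B = k"
    using number_field_span[OF k] by blast
  define C :: "(complex^4) set" where "C = (\<lambda>(i, b). axis i b) ` (UNIV \<times> B)"
  have "A \<subseteq> rat_span4.span C"
  proof
    fix x assume x: "x \<in> A"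
    have ax: "axis i y \<in> rat_span4.span C" if "y \<in> rat_span.span B" for i y
      using that
    proof (induction rule: rat_span.span_induct_alt)
      case base
      show ?case by (simp add: axis_eq_0_iff[THEN iffD2] rat_span4.span_zero)
    next
      case (step c b y)
      have "of_rat c *s axis i b \<in> rat_span4.span C"
        using step(1) by (intro rat_span4.span_scale rat_span4.span_base) (auto simp: C_def)
      from rat_span4.span_add[OF this step(2)] show ?case
        by (rule back_subst[of "\<lambda>z. z \<in> rat_span4.span C"]) (simp add: Finite_Cartesian_Product.vec_eq_iff axis_def)
    qed
    have "(\<Sum>i\<in>UNIV. axis i (x $ i)) \<in> rat_span4.span C"
      using A(3)[OF x] B by (intro rat_span4.span_sum ax) auto
    also have "(\<Sum>i\<in>UNIV. axis i (x $ i)) = x"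
      by (simp add: Finite_Cartesian_Product.vec_eq_iff axis_def)
    finally show "x \<in> rat_span4.span C" .
  qed
  moreover have "finite C" unfolding C_def using B by simp
  ultimately show ?thesis
    using finite_quotient[of C n] n unfolding multiples_def by (simp add: image_iff)
qed

section \<open>The action on hyperbolic space\<close>

lemma carrier_PSL2C: "carrier PSL2C = PSL_proj ` {A. det A = 1}"
  by (auto simp: PSL2C_def FactGroup_def RCOSETS_def PSL_proj_def SL2C_def)

lemma mult_PSL2C:
  assumes "det A = 1" "det B = 1"
  shows "PSL_proj A \<otimes>\<^bsub>PSL2C\<^esub> PSL_proj B = PSL_proj (A ** B)"
proof -
  have "A \<in> carrier SL2C" "B \<in> carrier SL2C" using assms by (simp_all add: SL2C_def)
  from normal.rcos_sum[OF normal_center_SL2C this] show ?thesis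
    by (simp add: PSL2C_def FactGroup_def PSL_proj_def) (simp add: SL2C_def)
qed

lemma one_PSL2C: "\<one>\<^bsub>PSL2C\<^esub> = PSL_proj (mat 1)"
  by (simp add: PSL2C_def FactGroup_def PSL_proj_eq)

lemma PSL_proj_eq_iff: "PSL_proj A = PSL_proj B \<longleftrightarrow> A = B \<or> A = - B"
  by (auto simp: PSL_proj_eq doubleton_eq_iff)

text \<open>A point of the upper half-space is encoded by a positive definite Hermitian form of determinant
  1, on which \<open>A\<close> acts by \<open>Q \<mapsto> A Q A\<^sup>*\<close>; this turns the Poincare extension into an action.\<close>

definition Hermitian_form :: "complex \<times> real \<Rightarrow> complex^2^2" where
  "Hermitian_form = (\<lambda>(z, t). vector
     [vector [(z * cnj z + of_real t * of_real t) / of_real t, z / of_real t],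
      vector [cnj z / of_real t, 1 / of_real t]])"

definition adjoint :: "complex^2^2 \<Rightarrow> complex^2^2" where
  "adjoint A = (\<chi> i j. cnj (A $ j $ i))"

lemma adjoint_mult: "adjoint (A ** B) = adjoint B ** adjoint A"
  by (simp add: adjoint_def matrix_matrix_mult_def mult.commute)

lemma matrix_mult_2:
  fixes a b c d :: "'a::comm_semiring_1"
  shows "(vector [vector [a, b], vector [c, d]] :: 'a^2^2) ** (vector [vector [e, f], vector [g, h]] :: 'a^2^2)
    = (vector [vector [a * e + b * g, a * f + b * h], vector [c * e + d * g, c * f + d * h]] :: 'a^2^2)"
  by (simp add: matrix_matrix_mult_def Finite_Cartesian_Product.vec_eq_iff forall_2 sum_2)

lemma Hermitian_form_inject:
  assumes "p \<in> H3" "q \<in> H3" "Hermitian_form p = Hermitian_form q"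
  shows "p = q"
  using assms
  by (auto simp: H3_def Hermitian_form_def Finite_Cartesian_Product.vec_eq_iff forall_2)

lemma Poincare_denominator_pos:
  fixes c d z :: complex and t :: real
  assumes "c \<noteq> 0 \<or> d \<noteq> 0" "t > 0"
  shows "(cmod (c * z + d))\<^sup>2 + (cmod c)\<^sup>2 * t\<^sup>2 > 0"
  using assms by (cases "c = 0") (auto intro: add_nonneg_pos add_pos_nonneg)

lemma Poincare_extension_H3:
  assumes "det A = 1" "p \<in> H3"
  shows "Poincare_extension A p \<in> H3"
proof -
  have "A $ 2 $ 1 \<noteq> 0 \<or> A $ 2 $ 2 \<noteq> 0" using assms(1) by (auto simp: det_2)
  then show ?thesis
    using assms(2) Poincare_denominator_pos[of "A $ 2 $ 1" "A $ 2 $ 2"]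
    by (auto simp: Poincare_extension_def H3_def Let_def)
qed

text \<open>The matrices are compared entry by entry. Only the upper left entry is not immediate:
  there a factor \<open>N\<close> has to cancel.\<close>

lemma Hermitian_form_Poincare_extension:
  assumes "det A = 1" "p \<in> H3"
  shows "Hermitian_form (Poincare_extension A p) = A ** Hermitian_form p ** adjoint A"
proof -
  obtain z t where p: "p = (z, t)" by fastforce
  define a b c d where "a = A $ 1 $ 1" "b = A $ 1 $ 2" "c = A $ 2 $ 1" "d = A $ 2 $ 2"
  note abcd = this
  define u v where "u = a * z + b" "v = c * z + d"
  note uv = this
  define T where "T = complex_of_real t"
  define r where "r = (cmod v)\<^sup>2 + (cmod c)\<^sup>2 * t\<^sup>2"
  define N where "N = v * cnj v + c * cnj c * (T * T)"
  define W where "W = u * cnj v + a * cnj c * (T * T)"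
  have t: "t > 0" using assms(2) by (simp add: p H3_def)
  have det: "a * d - b * c = 1" using assms(1) by (simp add: det_2 abcd)
  then have "c \<noteq> 0 \<or> d \<noteq> 0" by auto
  from Poincare_denominator_pos[OF this t] have "r > 0" by (simp add: r_def uv)
  have N: "of_real r = N"
    unfolding N_def T_def r_def of_real_add of_real_mult complex_norm_square
    by (simp add: power2_eq_square)
  have nz: "T \<noteq> 0" "N \<noteq> 0" using t \<open>r > 0\<close> by (auto simp: T_def simp flip: N)
  have cnj_N: "cnj N = N" "cnj T = T" by (simp_all add: T_def flip: N)
  have ext: "Poincare_extension A p = (W / N, t / r)"
  proof -
    have "Poincare_extension A p
        = ((u * cnj v + a * cnj c * of_real (t\<^sup>2)) / of_real r, t / r)"
      by (simp add: Poincare_extension_def p Let_def uv abcd r_def)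
    then show ?thesis by (simp add: N W_def T_def power2_eq_square)
  qed
  have one: "a * v - c * u = 1" using det by (simp add: uv algebra_simps)
  have "cnj a * cnj v - cnj c * cnj u = cnj (a * v - c * u)" by simp
  then have *: "(a * v - c * u) * (cnj a * cnj v - cnj c * cnj u) = 1"
    by (simp only: one complex_cnj_one mult_1)
  \<comment> \<open>Lagrange's identity for the vectors \<open>(u, a T)\<close> and
    \<open>(v, c T)\<close>: \<open>W\<close> is their Hermitian product, and their determinant has
    modulus \<open>T\<close> because \<open>a v - c u = 1\<close>.\<close>
  have "W * cnj W + T * T = W * cnj W + T * T * ((a * v - c * u) * (cnj a * cnj v - cnj c * cnj u))"
    unfolding * by simp
  also have "\<dots> = N * (u * cnj u + a * cnj a * (T * T))"
    by (simp add: W_def N_def cnj_N algebra_simps)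
  finally have norm: "W * cnj W + T * T = N * (u * cnj u + a * cnj a * (T * T))" .
  have "((W / N) * cnj (W / N) + T / N * (T / N)) / (T / N) = (W * cnj W + T * T) / (N * T)"
    using nz by (simp add: cnj_N field_simps)
  also have "\<dots> = (u * cnj u + a * cnj a * (T * T)) / T"
    unfolding norm using nz by simp
  finally have e11: "((W / N) * cnj (W / N) + T / N * (T / N)) / (T / N) = (u * cnj u + a * cnj a * (T * T)) / T" .
  have H: "Hermitian_form (W / N, t / r) = vector
      [vector [(u * cnj u + a * cnj a * (T * T)) / T, W / T], vector [cnj W / T, N / T]]"
    unfolding Hermitian_form_def prod.case of_real_divide N T_def[symmetric] e11
    using nz by (simp add: cnj_N)
  have A: "A = vector [vector [a, b], vector [c, d]]"
    by (simp add: abcd Finite_Cartesian_Product.vec_eq_iff forall_2)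
  have e: "(u * cnj u + a * cnj a * (T * T)) / T
      = (a * ((z * cnj z + T * T) / T) + b * (cnj z / T)) * cnj a + (a * (z / T) + b * (1 / T)) * cnj b"
    "W / T = (a * ((z * cnj z + T * T) / T) + b * (cnj z / T)) * cnj c + (a * (z / T) + b * (1 / T)) * cnj d"
    "cnj W / T = (c * ((z * cnj z + T * T) / T) + d * (cnj z / T)) * cnj a + (c * (z / T) + d * (1 / T)) * cnj b"
    "N / T = (c * ((z * cnj z + T * T) / T) + d * (cnj z / T)) * cnj c + (c * (z / T) + d * (1 / T)) * cnj d"
    using nz(1) cnj_N(2) by (simp_all add: W_def N_def uv add_divide_distrib algebra_simps)
  have "Hermitian_form p = vector [vector [(z * cnj z + T * T) / T, z / T], vector [cnj z / T, 1 / T]]"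
    by (simp add: Hermitian_form_def p T_def)
  moreover have "adjoint A = vector [vector [cnj a, cnj c], vector [cnj b, cnj d]]"
    by (simp add: adjoint_def abcd Finite_Cartesian_Product.vec_eq_iff forall_2)
  ultimately show ?thesis
    unfolding ext H by (simp only: A matrix_mult_2 e)
qed

lemma Poincare_extension_mult:
  assumes "det A = 1" "det B = 1" "p \<in> H3"
  shows "Poincare_extension (A ** B) p = Poincare_extension A (Poincare_extension B p)"
proof (rule Hermitian_form_inject)
  have AB: "det (A ** B) = 1" using assms by (simp add: det_mul)
  show "Poincare_extension (A ** B) p \<in> H3"
    "Poincare_extension A (Poincare_extension B p) \<in> H3"
    using assms AB by (simp_all add: Poincare_extension_H3)
  show "Hermitian_form (Poincare_extension (A ** B) p)
      = Hermitian_form (Poincare_extension A (Poincare_extension B p))"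
    using assms AB
    by (simp add: Hermitian_form_Poincare_extension Poincare_extension_H3 adjoint_mult matrix_mul_assoc)
qed

lemma PSL_act_H3: "g \<in> carrier PSL2C \<Longrightarrow> p \<in> H3 \<Longrightarrow> PSL_act g p \<in> H3"
  by (auto simp: carrier_PSL2C PSL_act_proj Poincare_extension_H3)

lemma PSL_act_mult:
  assumes "g \<in> carrier PSL2C" "h \<in> carrier PSL2C" "p \<in> H3"
  shows "PSL_act (g \<otimes>\<^bsub>PSL2C\<^esub> h) p = PSL_act g (PSL_act h p)"
  using assms by (auto simp: carrier_PSL2C mult_PSL2C PSL_act_proj Poincare_extension_mult)

lemma PSL_act_one: "PSL_act \<one>\<^bsub>PSL2C\<^esub> p = p"
  by (cases p) (simp add: one_PSL2C PSL_act_proj Poincare_extension_def mat_def)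

section \<open>Orbits, covers and commensurable orbifolds\<close>

lemma H3_orbit_act:
  assumes \<Gamma>: "subgroup \<Gamma> PSL2C" and "g \<in> \<Gamma>" "p \<in> H3"
  shows "H3_orbit \<Gamma> (PSL_act g p) = H3_orbit \<Gamma> p"
proof -
  interpret group PSL2C by (rule group_PSL2C)
  note carr = subgroup.mem_carrier[OF \<Gamma>]
  have "PSL_act h (PSL_act g p) = PSL_act (h \<otimes>\<^bsub>PSL2C\<^esub> g) p" if "h \<in> \<Gamma>" for h
    using PSL_act_mult[OF carr carr] that assms by simp
  then have "H3_orbit \<Gamma> (PSL_act g p) = (\<lambda>h. PSL_act h p) ` (\<lambda>h. h \<otimes>\<^bsub>PSL2C\<^esub> g) ` \<Gamma>"
    by (simp add: H3_orbit_def image_image)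
  also have "(\<lambda>h. h \<otimes>\<^bsub>PSL2C\<^esub> g) ` \<Gamma> = \<Gamma>"
    using coset_join2[OF carr[OF assms(2)] \<Gamma> assms(2)] by (auto simp: r_coset_def)
  finally show ?thesis by (simp add: H3_orbit_def)
qed

text \<open>The identity serves as the lift \<open>\<phi>\<close>, and each orbit of
  \<open>\<Lambda>\<close> is sent to the orbit of \<open>\<Gamma>\<close> containing it.\<close>

lemma finite_orbifold_cover_subgroup:
  assumes \<Lambda>: "subgroup \<Lambda> PSL2C" and \<Gamma>: "subgroup \<Gamma> PSL2C" and sub: "\<Lambda> \<subseteq> \<Gamma>"
    and fin: "finite_index PSL2C \<Lambda> \<Gamma>"
  shows "\<exists>\<pi>. finite_orbifold_cover \<Lambda> \<Gamma> \<pi>"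
proof -
  interpret group PSL2C by (rule group_PSL2C)
  note carr = subgroup.mem_carrier[OF \<Gamma>]
  define \<pi> where "\<pi> c = H3_orbit \<Gamma> (SOME p. p \<in> H3 \<and> H3_orbit \<Lambda> p = c)" for c
  have \<pi>: "\<pi> (H3_orbit \<Lambda> p) = H3_orbit \<Gamma> p" if p: "p \<in> H3" for p
  proof -
    define q where "q = (SOME q. q \<in> H3 \<and> H3_orbit \<Lambda> q = H3_orbit \<Lambda> p)"
    have q: "q \<in> H3 \<and> H3_orbit \<Lambda> q = H3_orbit \<Lambda> p"
      unfolding q_def by (rule someI[of _ p]) (use p in simp)
    have "p \<in> H3_orbit \<Lambda> p"
      unfolding H3_orbit_def using subgroup.one_closed[OF \<Lambda>] PSL_act_one[of p] by force
    then obtain h where "h \<in> \<Lambda>" "p = PSL_act h q"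
      using q unfolding H3_orbit_def by blast
    then show ?thesis
      using H3_orbit_act[OF \<Gamma>, of h q] q sub unfolding \<pi>_def q_def[symmetric] by auto
  qed
  \<comment> \<open>The set in the definition of a cover compares actions rather than group
    elements. For finite index it is enough that it is a subgroup between \<open>\<Lambda>\<close>
    and \<open>\<Gamma>\<close>.\<close>
  define S where "S = {g\<in>\<Gamma>. \<exists>h\<in>\<Lambda>. \<forall>p\<in>H3. PSL_act h p = PSL_act g p}"
  have "subgroup S PSL2C"
  proof (rule subgroupI)
    show "S \<subseteq> carrier PSL2C" using carr by (auto simp: S_def)
    show "S \<noteq> {}" using \<Lambda> \<Gamma> subgroup.one_closed by (force simp: S_def)
  next
    fix g assume "g \<in> S"
    then obtain h where g: "g \<in> \<Gamma>" and h: "h \<in> \<Lambda>" "\<And>p. p \<in> H3 \<Longrightarrow> PSL_act h p = PSL_act g p"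
      by (auto simp: S_def)
    have hG: "h \<in> \<Gamma>" using h sub by blast
    have "PSL_act (inv\<^bsub>PSL2C\<^esub> h) p = PSL_act (inv\<^bsub>PSL2C\<^esub> g) p" if p: "p \<in> H3" for p
    proof -
      let ?q = "PSL_act (inv\<^bsub>PSL2C\<^esub> g) p"
      have q: "?q \<in> H3" using p g carr by (intro PSL_act_H3) auto
      have "PSL_act h ?q = PSL_act (g \<otimes>\<^bsub>PSL2C\<^esub> inv\<^bsub>PSL2C\<^esub> g) p"
        using h(2)[OF q] PSL_act_mult[of g "inv\<^bsub>PSL2C\<^esub> g" p] g carr p by simp
      also have "\<dots> = p" using g carr by (simp add: PSL_act_one)
      finally have "PSL_act (inv\<^bsub>PSL2C\<^esub> h) p = PSL_act (inv\<^bsub>PSL2C\<^esub> h \<otimes>\<^bsub>PSL2C\<^esub> h) ?q"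
        using PSL_act_mult[of "inv\<^bsub>PSL2C\<^esub> h" h ?q] hG carr q by simp
      also have "\<dots> = ?q" using hG carr by (simp add: PSL_act_one)
      finally show ?thesis .
    qed
    then show "inv\<^bsub>PSL2C\<^esub> g \<in> S"
      unfolding S_def using subgroup.m_inv_closed[OF \<Gamma> g] subgroup.m_inv_closed[OF \<Lambda> h(1)] by blast
  next
    fix g g' assume "g \<in> S" "g' \<in> S"
    then obtain h h' where g: "g \<in> \<Gamma>" "g' \<in> \<Gamma>"
      and h: "h \<in> \<Lambda>" "\<And>p. p \<in> H3 \<Longrightarrow> PSL_act h p = PSL_act g p"
      and h': "h' \<in> \<Lambda>" "\<And>p. p \<in> H3 \<Longrightarrow> PSL_act h' p = PSL_act g' p"
      by (auto simp: S_def)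
    have "PSL_act (h \<otimes>\<^bsub>PSL2C\<^esub> h') p = PSL_act (g \<otimes>\<^bsub>PSL2C\<^esub> g') p" if "p \<in> H3" for p
      using that g h h' sub carr by (simp add: PSL_act_mult PSL_act_H3 subset_iff)
    then show "g \<otimes>\<^bsub>PSL2C\<^esub> g' \<in> S"
      unfolding S_def using subgroup.m_closed[OF \<Gamma> g] subgroup.m_closed[OF \<Lambda> h(1) h'(1)] by blast
  qed
  moreover have "\<Lambda> \<subseteq> S" using sub by (auto simp: S_def)
  ultimately have "finite_index PSL2C S \<Gamma>"
    using finite_index_mono[OF fin _ \<Lambda> _ \<Gamma>] by blast
  moreover have "H3_isometry (\<lambda>p. p)"
    by (simp add: H3_isometry_def bij_betw_def)
  ultimately show ?thesis
    unfolding finite_orbifold_cover_def S_def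
    by (intro exI[of _ \<pi>] exI[of _ "\<lambda>p. p"]) (use \<pi> sub in auto)
qed

lemma orbifold_commensurable_if_commensurable:
  assumes "commensurable PSL2C \<Gamma> \<Gamma>'" "subgroup \<Gamma> PSL2C" "subgroup \<Gamma>' PSL2C"
  shows "orbifold_commensurable \<Gamma> \<Gamma>'"
proof -
  interpret group PSL2C by (rule group_PSL2C)
  have sub: "subgroup (\<Gamma> \<inter> \<Gamma>') PSL2C" using assms(2,3) by (rule subgroups_Inter_pair)
  have "\<exists>\<pi>. finite_orbifold_cover (\<Gamma> \<inter> \<Gamma>') \<Gamma> \<pi>"
    by (rule finite_orbifold_cover_subgroup[OF sub assms(2)])
       (use assms(1) in \<open>auto simp: commensurable_def\<close>)
  moreover have "\<exists>\<pi>. finite_orbifold_cover (\<Gamma> \<inter> \<Gamma>') \<Gamma>' \<pi>"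
    by (rule finite_orbifold_cover_subgroup[OF sub assms(3)])
       (use assms(1) in \<open>auto simp: commensurable_def\<close>)
  ultimately show ?thesis
    using sub unfolding orbifold_commensurable_def by blast
qed

text \<open>Such an \<open>A\<close> has trace 0 and acts as the half-turn about the geodesic
  joining its two fixed points on the boundary; a point of this axis is exhibited.\<close>

lemma involution_fixed_point:
  assumes "det A = 1" "A ** A = - mat 1"
  shows "\<exists>p\<in>H3. Poincare_extension A p = p"
proof -
  define a b c d where "a = A $ 1 $ 1" "b = A $ 1 $ 2" "c = A $ 2 $ 1" "d = A $ 2 $ 2"
  note abcd = this
  have det: "a * d - b * c = 1" using assms(1) by (simp add: det_2 abcd)
  have sq: "a * a + b * c = -1" "b * (a + d) = 0" "c * (a + d) = 0"
    using assms(2)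
    by (auto simp: Finite_Cartesian_Product.vec_eq_iff forall_2 matrix_matrix_mult_def sum_2 mat_def
        abcd algebra_simps)
  have d: "d = - a"
  proof (rule ccontr)
    assume "d \<noteq> - a"
    then have "a + d \<noteq> 0" by (metis add_eq_0_iff)
    \<comment> \<open>The sum of \<open>det\<close> and the first equation of \<open>sq\<close>. If
      \<open>a + d\<close> were non-zero, then \<open>a\<close>, \<open>b\<close> and
      \<open>c\<close> would all vanish.\<close>
    moreover have "a * (a + d) = 0" using det sq(1) by (simp add: algebra_simps)
    ultimately show False using sq by auto
  qed
  show ?thesis
  proof (cases "c = 0")
    case False
    \<comment> \<open>The boundary fixed points are \<open>(a + \<i>) / c\<close> and
      \<open>(a - \<i>) / c\<close>; the chosen point is the top of the semicircle joining
      them.\<close>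
    have "Poincare_extension A (a / c, 1 / cmod c) = (a / c, 1 / cmod c)"
      using False complex_norm_square[of c]
      by (simp add: Poincare_extension_def Let_def d power_divide field_simps power2_eq_square
          flip: abcd)
    moreover have "(a / c, 1 / cmod c) \<in> H3" using False by (simp add: H3_def)
    ultimately show ?thesis by blast
  next
    case True
    then have aa: "a * a = -1" using sq(1) by simp
    then have "cmod a * cmod a = 1" by (metis norm_minus_cancel norm_mult norm_one)
    then have na: "cmod a = 1"
      by (metis norm_ge_zero power2_eq_1_iff power2_eq_square zero_le_one neg_0_le_iff_le not_one_le_zero)
    then have "a * cnj a = a * - a" using aa by (simp flip: complex_norm_square)
    moreover have "a \<noteq> 0" using aa by auto
    ultimately have ca: "cnj a = - a" by (metis mult_left_cancel)
    \<comment> \<open>Now infinity is a boundary fixed point and the axis is the vertical line over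
      the other one, \<open>a * b / 2\<close>; the height 1 is an arbitrary choice.\<close>
    have "Poincare_extension A (a * b / 2, 1) = (a * b / 2, 1)"
    proof -
      have "a * (a * y) = - y" for y using aa by (simp flip: mult.assoc)
      then show ?thesis
        by (simp add: Poincare_extension_def Let_def d na ca True algebra_simps flip: abcd)
    qed
    moreover have "(a * b / 2, 1) \<in> H3" by (simp add: H3_def)
    ultimately show ?thesis by blast
  qed
qed

section \<open>Orders in quaternion algebras\<close>

definition quaternion_conj :: "complex^4 \<Rightarrow> complex^4" where
  "quaternion_conj x = vector [x$1, - x$2, - x$3, - x$4]"

text \<open>The inner automorphism \<open>x \<mapsto> i x i\<^sup>-\<^sup>1\<close>.\<close>

definition conj_by_i :: "complex^4 \<Rightarrow> complex^4" where
  "conj_by_i x = vector [x$1, x$2, - x$3, - x$4]"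

definition quaternion_one :: "complex^4" where
  "quaternion_one = vector [1, 0, 0, 0]"

definition quaternion_i :: "complex^4" where
  "quaternion_i = vector [0, 1, 0, 0]"

definition quaternion_j :: "complex^4" where
  "quaternion_j = vector [0, 0, 1, 0]"

lemmas quaternion_defs = quaternion_mult_def quaternion_conj_def conj_by_i_def quaternion_one_def
  quaternion_i_def quaternion_j_def reduced_norm_def Finite_Cartesian_Product.vec_eq_iff forall_4 vector_4
  vector_add_component vector_minus_component vector_uminus_component vector_smult_component

lemma quaternion_mult_assoc:
  "quaternion_mult a b (quaternion_mult a b x y) z = quaternion_mult a b x (quaternion_mult a b y z)"
  unfolding quaternion_defs by (simp add: algebra_simps)

lemma quaternion_mult_one:
  "quaternion_mult a b quaternion_one x = x" "quaternion_mult a b x quaternion_one = x"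
  by (simp_all add: quaternion_defs)

lemma quaternion_mult_add:
  "quaternion_mult a b (x + y) z = quaternion_mult a b x z + quaternion_mult a b y z"
  "quaternion_mult a b x (y + z) = quaternion_mult a b x y + quaternion_mult a b x z"
  "quaternion_mult a b (x - y) z = quaternion_mult a b x z - quaternion_mult a b y z"
  "quaternion_mult a b x (y - z) = quaternion_mult a b x y - quaternion_mult a b x z"
  unfolding quaternion_defs by (simp_all add: algebra_simps)

lemma quaternion_mult_scale:
  "quaternion_mult a b (c *s x) y = c *s quaternion_mult a b x y"
  "quaternion_mult a b x (c *s y) = c *s quaternion_mult a b x y"
  unfolding quaternion_defs by (simp_all add: algebra_simps)

lemma quaternion_conj_linear:
  "quaternion_conj (x + y) = quaternion_conj x + quaternion_conj y"
  "quaternion_conj (c *s x) = c *s quaternion_conj x"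
  by (simp_all add: quaternion_defs)

lemma conj_by_i_linear:
  "conj_by_i (x + y) = conj_by_i x + conj_by_i y"
  "conj_by_i (c *s x) = c *s conj_by_i x"
  by (simp_all add: quaternion_defs)

lemma quaternion_conj_mult:
  "quaternion_conj (quaternion_mult a b x y) = quaternion_mult a b (quaternion_conj y) (quaternion_conj x)"
  unfolding quaternion_defs by (simp add: algebra_simps)

lemma conj_by_i_mult:
  "conj_by_i (quaternion_mult a b x y) = quaternion_mult a b (conj_by_i x) (conj_by_i y)"
  unfolding quaternion_defs by (simp add: algebra_simps)

lemma conj_by_i_conj_by_i [simp]: "conj_by_i (conj_by_i x) = x"
  by (simp add: quaternion_defs)

lemma conj_by_i_one: "conj_by_i quaternion_one = quaternion_one"
  by (simp add: quaternion_defs)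

lemma conj_by_i_quaternion_conj: "conj_by_i (quaternion_conj x) = quaternion_conj (conj_by_i x)"
  by (simp add: quaternion_defs)

text \<open>Conjugation by \<open>i\<close> written without an inverse, the form that
  \<open>\<rho>\<close> carries over to matrices.\<close>

lemma quaternion_i_mult:
  "quaternion_mult a b quaternion_i x = quaternion_mult a b (conj_by_i x) quaternion_i"
  by (simp add: quaternion_defs)

lemma mult_quaternion_conj:
  "quaternion_mult a b x (quaternion_conj x) = reduced_norm a b x *s quaternion_one"
  "quaternion_mult a b (quaternion_conj x) x = reduced_norm a b x *s quaternion_one"
  unfolding quaternion_defs by (simp_all add: power2_eq_square algebra_simps)

lemma reduced_norm_conj [simp]:
  "reduced_norm a b (quaternion_conj x) = reduced_norm a b x"
  "reduced_norm a b (conj_by_i x) = reduced_norm a b x"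
  "reduced_norm a b quaternion_one = 1"
  by (simp_all add: quaternion_defs)

locale order_in_quaternion_algebra =
  fixes k :: "complex set" and a b :: complex and \<O> :: "(complex^4) set"
  assumes k: "number_field k" and a: "a \<in> k" "a \<noteq> 0" and b: "b \<in> k" "b \<noteq> 0"
    and order: "quaternion_order k a b \<O>"
begin

abbreviation qmult (infixl "\<cdot>" 70) where "x \<cdot> y \<equiv> quaternion_mult a b x y"

lemma subfield_k: "subfield k CC"
  using k by (simp add: number_field_def)

lemmas k_closed = subfield_CC_closed[OF subfield_k]

lemma ring_Q: "ring (quaternion_algebra k a b)"
  using a b k_closed(7) by (intro ring_quaternion_algebra)

lemma order_subset: "x \<in> \<O> \<Longrightarrow> x $ n \<in> k"
proof -
  assume "x \<in> \<O>"
  moreover have "\<O> \<subseteq> carrier (quaternion_algebra k a b)"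
    using order unfolding quaternion_order_def by (blast dest: subringE(1))
  ultimately show ?thesis by (auto simp: quaternion_algebra_def)
qed

lemma order_closed:
  "0 \<in> \<O>" "quaternion_one \<in> \<O>"
  "\<And>x y. x \<in> \<O> \<Longrightarrow> y \<in> \<O> \<Longrightarrow> x + y \<in> \<O>"
  "\<And>x y. x \<in> \<O> \<Longrightarrow> y \<in> \<O> \<Longrightarrow> x \<cdot> y \<in> \<O>"
  "\<And>x. x \<in> \<O> \<Longrightarrow> - x \<in> \<O>"
  "\<And>x y. x \<in> \<O> \<Longrightarrow> y \<in> \<O> \<Longrightarrow> x - y \<in> \<O>"
proof -
  interpret Q: ring "quaternion_algebra k a b" by (rule ring_Q)
  have S: "subring \<O> (quaternion_algebra k a b)" using order by (simp add: quaternion_order_def)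
  show c: "0 \<in> \<O>" "quaternion_one \<in> \<O>"
    "\<And>x y. x \<in> \<O> \<Longrightarrow> y \<in> \<O> \<Longrightarrow> x + y \<in> \<O>"
    "\<And>x y. x \<in> \<O> \<Longrightarrow> y \<in> \<O> \<Longrightarrow> x \<cdot> y \<in> \<O>"
    using subringE(2,3,6,7)[OF S] by (simp_all add: quaternion_algebra_def quaternion_one_def)
  show m: "- x \<in> \<O>" if "x \<in> \<O>" for x
  proof -
    have "\<ominus>\<^bsub>quaternion_algebra k a b\<^esub> x = - x"
      using order_subset[OF that] k_closed(5)
      by (intro Q.minus_equality) (auto simp: quaternion_algebra_def)
    then show ?thesis using subringE(5)[OF S that] by simp
  qed
  show "x - y \<in> \<O>" if "x \<in> \<O>" "y \<in> \<O>" for x y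
    using c(3)[OF that(1) m[OF that(2)]] by simp
qed

lemma order_sum: "(\<And>i. i \<in> I \<Longrightarrow> f i \<in> \<O>) \<Longrightarrow> sum f I \<in> \<O>"
  by (induction I rule: infinite_finite_induct) (auto intro: order_closed)

lemma ring_of_integers_mult:
  "r \<in> ring_of_integers k \<Longrightarrow> s \<in> ring_of_integers k \<Longrightarrow> r * s \<in> ring_of_integers k"
  by (auto simp: ring_of_integers_def algebraic_int_mult k_closed)

lemma order_scale:
  assumes "r \<in> ring_of_integers k" "x \<in> \<O>"
  shows "r *s x \<in> \<O>"
proof -
  obtain S where S: "\<O> = linear_span (ring_of_integers k) S"
    using order by (auto simp: quaternion_order_def)
  then obtain c T where T: "x = (\<Sum>s\<in>T. c s *s s)" "finite T" "T \<subseteq> S" "c ` T \<subseteq> ring_of_integers k"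
    using assms(2) by (auto simp: linear_span_def)
  have "r *s x = (\<Sum>s\<in>T. (r * c s) *s s)"
    by (simp add: T(1) vec.scale_sum_right)
  moreover have "(\<lambda>s. r * c s) ` T \<subseteq> ring_of_integers k"
    using T(4) ring_of_integers_mult[OF assms(1)] by auto
  ultimately show ?thesis
    unfolding S linear_span_def using T(2,3)
    by (intro CollectI exI[of _ "\<lambda>s. r * c s"] exI[of _ T]) simp
qed

section \<open>Denominators and residue classes in an order\<close>

lemma of_nat_integer: "of_nat n \<in> ring_of_integers k"
proof -
  have "of_nat n \<in> k" by (induction n) (auto intro: k_closed)
  then show ?thesis by (simp add: ring_of_integers_def int_imp_algebraic_int)
qed

text \<open>\<open>\<O>\<close> spans the algebra over \<open>k\<close>, and each coefficient
  becomes an algebraic integer after multiplication by a positive natural number; these numbers are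
  multiplied together.\<close>

lemma order_denominator:
  assumes "\<And>n. x $ n \<in> k"
  shows "\<exists>n::nat. n > 0 \<and> of_nat n *s x \<in> \<O>"
proof -
  have "x \<in> linear_span k \<O>"
    using order assms by (simp add: quaternion_order_def quaternion_algebra_def)
  then obtain c T where x: "x = (\<Sum>s\<in>T. c s *s s)" and "finite T" "T \<subseteq> \<O>" "c ` T \<subseteq> k"
    by (auto simp: linear_span_def)
  from this(2-) have "\<exists>n::nat. n > 0 \<and> of_nat n *s (\<Sum>s\<in>T. c s *s s) \<in> \<O>"
  proof induction
    case empty
    show ?case by (intro exI[of _ 1]) (simp add: order_closed)
  next
    case (insert t T)
    then obtain n :: nat where n: "n > 0" "of_nat n *s (\<Sum>s\<in>T. c s *s s) \<in> \<O>" by auto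
    obtain m :: nat where m: "m > 0" "algebraic_int (of_nat m * c t)"
      using number_field_denominator[OF k, of "c t"] insert by auto
    have "of_nat m \<in> k" using of_nat_integer[of m] by (simp add: ring_of_integers_def)
    then have "of_nat m * c t \<in> ring_of_integers k"
      using m insert by (auto simp: ring_of_integers_def intro: k_closed)
    then have "of_nat n *s ((of_nat m * c t) *s t) \<in> \<O>"
      using insert by (intro order_scale[OF of_nat_integer] order_scale) auto
    moreover have "of_nat m *s (of_nat n *s (\<Sum>s\<in>T. c s *s s)) \<in> \<O>"
      by (intro order_scale[OF of_nat_integer] n)
    ultimately have "of_nat n *s ((of_nat m * c t) *s t) + of_nat m *s (of_nat n *s (\<Sum>s\<in>T. c s *s s)) \<in> \<O>"
      by (rule order_closed)
    then have "of_nat (m * n) *s (\<Sum>s\<in>insert t T. c s *s s) \<in> \<O>"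
      using insert by (simp add: vector_add_ldistrib mult_ac)
    then show ?case using m n by (intro exI[of _ "m * n"]) simp
  qed
  then show ?thesis by (simp add: x)
qed

text \<open>Meant for quaternion conjugation and for \<open>conj_by_i\<close>. Denominators at the
  finitely many generators suffice, since \<open>f\<close> commutes with the coefficients; their
  product works for all of \<open>\<O>\<close>.\<close>

lemma order_linear_denominator:
  assumes add: "\<And>x y. f (x + y) = f x + f y" and scale: "\<And>c x. f (c *s x) = c *s f x"
    and f: "\<And>x n. (\<And>n. x $ n \<in> k) \<Longrightarrow> f x $ n \<in> k"
  shows "\<exists>n::nat. n > 0 \<and> (\<forall>x\<in>\<O>. of_nat n *s f x \<in> \<O>)"
proof -
  obtain S where S: "finite S" "\<O> = linear_span (ring_of_integers k) S"
    using order by (auto simp: quaternion_order_def)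
  have "s \<in> \<O>" if "s \<in> S" for s
    unfolding S(2) linear_span_def using that of_nat_integer[of 1]
    by (intro CollectI exI[of _ "\<lambda>_. 1"] exI[of _ "{s}"]) auto
  then have "\<exists>n::nat. n > 0 \<and> of_nat n *s f s \<in> \<O>" if "s \<in> S" for s
    using that by (intro order_denominator f order_subset)
  then obtain n :: "_ \<Rightarrow> nat" where n: "\<And>s. s \<in> S \<Longrightarrow> n s > 0 \<and> of_nat (n s) *s f s \<in> \<O>"
    by metis
  define m where "m = (\<Prod>s\<in>S. n s)"
  have m: "of_nat m *s f s \<in> \<O>" if "s \<in> S" for s
  proof -
    have "m = (\<Prod>s\<in>S - {s}. n s) * n s"
      unfolding m_def using prod.remove[OF S(1) that, of n] by (simp add: mult.commute)
    then have "of_nat m *s f s = of_nat (\<Prod>s\<in>S - {s}. n s) *s (of_nat (n s) *s f s)"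
      by simp
    also have "\<dots> \<in> \<O>" using n[OF that] by (intro order_scale[OF of_nat_integer, of "of_nat (n s) *s f s"]) simp
    finally show ?thesis .
  qed
  have f0: "f 0 = 0" using scale[of 0 0] by simp
  have "of_nat m *s f x \<in> \<O>" if x: "x \<in> \<O>" for x
  proof -
    obtain c T where T: "x = (\<Sum>s\<in>T. c s *s s)" "finite T" "T \<subseteq> S" "c ` T \<subseteq> ring_of_integers k"
      using x unfolding S(2) by (auto simp: linear_span_def)
    have "f x = (\<Sum>s\<in>T. c s *s f s)"
      unfolding T(1) using T(2) by induction (auto simp: f0 add scale)
    then have "of_nat m *s f x = (\<Sum>s\<in>T. c s *s (of_nat m *s f s))"
      by (simp add: vec.scale_sum_right mult.commute)
    also have "\<dots> \<in> \<O>"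
      using T by (intro order_sum order_scale m) auto
    finally show ?thesis .
  qed
  moreover have "m > 0" unfolding m_def using n by (intro prod_pos) auto
  ultimately show ?thesis by blast
qed

text \<open>\<open>cls\<close> picks representatives modulo \<open>n \<O>\<close>. It supplies the
  finiteness both for the pigeonhole argument in \<open>quaternion_conj_mem\<close> and for the
  index in \<open>finite_index_norm_one_units_inter\<close>.\<close>

lemma order_classes:
  assumes "n > 0"
  shows "\<exists>cls :: complex^4 \<Rightarrow> complex^4. finite (cls ` \<O>) \<and>
    (\<forall>x\<in>\<O>. \<forall>y\<in>\<O>. cls x = cls y \<longrightarrow> (\<exists>z\<in>\<O>. x - y = of_nat n *s z))"
proof -
  obtain F where F: "finite F" "\<forall>x\<in>\<O>. \<exists>f\<in>F. \<exists>z\<in>\<O>. x - f = of_nat n *s z"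
    using finite_quotient_vec4[OF k order_closed(1,6) order_subset assms] by blast
  then obtain cls where cls: "\<And>x. x \<in> \<O> \<Longrightarrow> cls x \<in> F \<and> (\<exists>z\<in>\<O>. x - cls x = of_nat n *s z)"
    by metis
  have "\<exists>z\<in>\<O>. x - y = of_nat n *s z" if xy: "x \<in> \<O>" "y \<in> \<O>" "cls x = cls y" for x y
  proof -
    obtain z z' where z: "z \<in> \<O>" "z' \<in> \<O>" "x - cls x = of_nat n *s z" "y - cls y = of_nat n *s z'"
      using cls xy by metis
    have "x - y = (x - cls x) - (y - cls y)" using xy by simp
    also have "\<dots> = of_nat n *s (z - z')" unfolding z by (simp add: vec.scale_right_diff_distrib)
    finally show ?thesis using order_closed(6)[OF z(1,2)] by blast
  qed
  moreover have "finite (cls ` \<O>)" using cls F(1) by (auto intro: finite_subset)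
  ultimately show ?thesis by blast
qed

section \<open>Inverses of norm one elements\<close>

primrec qpower :: "complex^4 \<Rightarrow> nat \<Rightarrow> complex^4" where
  "qpower y 0 = quaternion_one"
| "qpower y (Suc m) = y \<cdot> qpower y m"

lemma qpower_add: "qpower y (m + n) = qpower y m \<cdot> qpower y n"
  by (induction m) (simp_all add: quaternion_mult_one quaternion_mult_assoc)

lemma reduced_norm_qpower: "reduced_norm a b y = 1 \<Longrightarrow> reduced_norm a b (qpower y m) = 1"
  by (induction m) (simp_all add: reduced_norm_mult)

lemma qpower_mem: "y \<in> \<O> \<Longrightarrow> qpower y m \<in> \<O>"
  by (induction m) (auto intro: order_closed)

text \<open>The powers of \<open>y\<^sup>-\<^sup>1\<close> have a common denominator \<open>n\<close>, hence two of them, \<open>y\<^sup>-\<^sup>m\<close> and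
  \<open>y\<^sup>-\<^sup>l\<close> with \<open>l < m\<close>, are congruent modulo \<open>\<O>\<close>. Multiply their difference by
  \<open>y\<^sup>m\<^sup>-\<^sup>1\<close>.\<close>

lemma quaternion_conj_mem:
  assumes y: "y \<in> \<O>" "reduced_norm a b y = 1"
  shows "quaternion_conj y \<in> \<O>"
proof -
  have "quaternion_conj x $ n \<in> k" if "\<And>n. x $ n \<in> k" for x n
  proof -
    have "\<forall>n. quaternion_conj x $ n \<in> k"
      using that k_closed(5) by (simp add: forall_4 quaternion_conj_def vector_4)
    then show ?thesis by blast
  qed
  then obtain n :: nat where n: "n > 0" "\<And>x. x \<in> \<O> \<Longrightarrow> of_nat n *s quaternion_conj x \<in> \<O>"
    using order_linear_denominator[of quaternion_conj] quaternion_conj_linear by blast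
  obtain cls :: "complex^4 \<Rightarrow> complex^4" where cls: "finite (cls ` \<O>)"
    "\<And>x y. x \<in> \<O> \<Longrightarrow> y \<in> \<O> \<Longrightarrow> cls x = cls y \<Longrightarrow> \<exists>z\<in>\<O>. x - y = of_nat n *s z"
    using order_classes[OF n(1)] by metis
  \<comment> \<open>\<open>P m\<close> is \<open>n\<close> times the inverse of
    \<open>qpower y m\<close>. It lies in \<open>\<O>\<close>, so the pigeonhole takes place modulo
    \<open>n \<O>\<close>; cancelling \<open>n\<close> afterwards leaves a congruence modulo
    \<open>\<O>\<close>.\<close>
  define P where "P m = of_nat n *s quaternion_conj (qpower y m)" for m
  have P: "P m \<in> \<O>" for m
    unfolding P_def by (intro n qpower_mem y)
  have "range (\<lambda>m. cls (P m)) \<subseteq> cls ` \<O>" using P by blast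
  then have "finite (range (\<lambda>m. cls (P m)))" using cls(1) by (rule finite_subset)
  then have "\<not> inj (\<lambda>m. cls (P m))" using finite_imageD by blast
  then obtain m l where "m \<noteq> l" "cls (P m) = cls (P l)" by (auto simp: inj_def)
  then obtain m l where ml: "l < m" "cls (P m) = cls (P l)"
    by (metis linorder_neq_iff)
  obtain z where z: "z \<in> \<O>" "P m - P l = of_nat n *s z"
    using cls(2)[OF P P ml(2)] by blast
  have "of_nat n *s (quaternion_conj (qpower y m) - quaternion_conj (qpower y l)) = of_nat n *s z"
    using z(2) by (simp add: P_def vec.scale_right_diff_distrib)
  then have eq: "quaternion_conj (qpower y m) - quaternion_conj (qpower y l) = z"
    using n(1) by (simp only: vec.scale_left_imp_eq vec.scale_cancel_left) simp
  \<comment> \<open>Thus \<open>e + l = m - 1\<close>, and multiplication by \<open>q\<close> turns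
    the two inverse powers into the inverse of \<open>y\<close> and into
    \<open>qpower y e\<close>.\<close>
  obtain e where m: "m = Suc (e + l)" using less_imp_Suc_add[OF ml(1)] by (auto simp: add.commute)
  define q where "q = qpower y (e + l)"
  have q: "q \<in> \<O>" "reduced_norm a b q = 1"
    unfolding q_def using y by (simp_all add: qpower_mem reduced_norm_qpower)
  have "q \<cdot> quaternion_conj (qpower y m) = (q \<cdot> quaternion_conj q) \<cdot> quaternion_conj y"
    by (simp add: m q_def quaternion_conj_mult quaternion_mult_assoc)
  also have "\<dots> = quaternion_conj y"
    by (simp add: mult_quaternion_conj q quaternion_mult_one)
  finally have 1: "q \<cdot> quaternion_conj (qpower y m) = quaternion_conj y" .
  have 2: "q \<cdot> quaternion_conj (qpower y l) = qpower y e"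
    using y by (simp add: q_def qpower_add quaternion_mult_assoc mult_quaternion_conj
        reduced_norm_qpower quaternion_mult_one)
  have "quaternion_conj y = q \<cdot> z + qpower y e"
    by (simp add: quaternion_mult_add 1 2 flip: eq)
  then show ?thesis
    using q z y by (simp add: order_closed qpower_mem)
qed

lemma conj_by_i_denominator:
  "\<exists>n::nat. n > 0 \<and> (\<forall>x\<in>\<O>. of_nat n *s conj_by_i x \<in> \<O>)"
proof (rule order_linear_denominator)
  fix x :: "complex^4" and n assume "\<And>n. x $ n \<in> k"
  then have "\<forall>n. conj_by_i x $ n \<in> k"
    using k_closed(5) by (simp add: forall_4 conj_by_i_def vector_4)
  then show "conj_by_i x $ n \<in> k" by blast
qed (simp_all add: conj_by_i_linear)

end

section \<open>Arithmetic groups\<close>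

lemma mat_mult_component: "(mat c ** M) $ i $ j = c * (M $ i $ j)" for M :: "complex^2^2"
  using exhaust_2[of i] exhaust_2[of j] by (auto simp: matrix_matrix_mult_def mat_def sum_2)

lemma det_scalar_mult: "det (mat c ** M) = c\<^sup>2 * det M" for M :: "complex^2^2"
  by (simp add: det_2 mat_mult_component power2_eq_square algebra_simps)

lemma trace_2: "trace A = A $ 1 $ 1 + A $ 2 $ 2" for A :: "complex^2^2"
  by (simp add: trace_def sum_2)

text \<open>\<open>L ** M ** L\<close> is \<open>- c M\<close> by anticommutation, but has
  \<open>c\<close> times the trace of \<open>M\<close> by cyclicity of the trace.\<close>

lemma trace_eq_0_if_anticommute:
  fixes M L :: "complex^2^2"
  assumes "M ** L = - (L ** M)" "L ** L = mat c" "c \<noteq> 0"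
  shows "trace M = 0"
proof -
  have "(L ** M) ** L = - (mat c ** M)"
    by (metis assms(1,2) matrix_mul_assoc matrix_mult_uminus(2))
  then have "trace ((L ** M) ** L) = - (c * trace M)"
    by (simp add: trace_2 mat_mult_component distrib_left)
  moreover have "trace ((L ** M) ** L) = trace (mat c ** M)"
    using assms(2) by (metis trace_mul_sym matrix_mul_assoc)
  moreover have "trace (mat c ** M) = c * trace M"
    by (simp add: trace_2 mat_mult_component distrib_left)
  ultimately show ?thesis using assms(3) by simp
qed

text \<open>The first assumption identifies \<open>B\<close> as the adjugate of
  \<open>A\<close>.\<close>

lemma det_eq_if_adjugate:
  fixes A B :: "complex^2^2"
  assumes "A + B = mat (trace A)" "A ** B = mat c"
  shows "det A = c"
proof -
  have "A $ i $ j + B $ i $ j = mat (trace A) $ i $ j" for i j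
    by (simp flip: assms(1))
  from this[of 1 1] this[of 2 1] have B: "B $ 1 $ 1 = A $ 2 $ 2" "B $ 2 $ 1 = - A $ 2 $ 1"
    by (simp_all add: mat_def trace_2 eq_neg_iff_add_eq_0 add.commute)
  have "(A ** B) $ 1 $ 1 = c" by (simp add: assms(2) mat_def)
  then show ?thesis by (simp add: matrix_matrix_mult_def sum_2 B det_2)
qed

locale embedded_order = order_in_quaternion_algebra +
  fixes \<sigma> :: "complex \<Rightarrow> complex" and \<rho> :: "complex^4 \<Rightarrow> complex^2^2"
  assumes \<sigma>: "\<sigma> \<in> embeddings k" and \<rho>: "algebra_embedding k a b \<sigma> \<rho>"
begin

section \<open>Trace and determinant under an arbitrary embedding\<close>

lemma \<sigma>_hom:
  "\<sigma> 1 = 1" "\<And>x y. x \<in> k \<Longrightarrow> y \<in> k \<Longrightarrow> \<sigma> (x * y) = \<sigma> x * \<sigma> y"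
  "\<And>x y. x \<in> k \<Longrightarrow> y \<in> k \<Longrightarrow> \<sigma> (x + y) = \<sigma> x + \<sigma> y"
  using \<sigma> unfolding embeddings_def ring_hom_def by (simp_all add: ring_of_type_algebra_def)

lemma \<sigma>_0: "\<sigma> 0 = 0"
  using \<sigma>_hom(3)[of 0 0] k_closed(1) by simp

lemma \<sigma>_uminus: "x \<in> k \<Longrightarrow> \<sigma> (- x) = - \<sigma> x"
  using \<sigma>_hom(3)[of x "- x"] k_closed(5) \<sigma>_0 by (simp add: eq_neg_iff_add_eq_0 add.commute)

abbreviation B :: "(complex^4) set" where "B \<equiv> carrier (quaternion_algebra k a b)"

lemma B_iff: "x \<in> B \<longleftrightarrow> (\<forall>n. x $ n \<in> k)"
  by (simp add: quaternion_algebra_def)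

lemma order_subset_B: "\<O> \<subseteq> B"
  using order_subset by (auto simp: B_iff)

lemma B_closed:
  "quaternion_one \<in> B" "quaternion_i \<in> B" "quaternion_j \<in> B"
  "\<And>x y. x \<in> B \<Longrightarrow> y \<in> B \<Longrightarrow> x \<cdot> y \<in> B" "\<And>x y. x \<in> B \<Longrightarrow> y \<in> B \<Longrightarrow> x + y \<in> B"
  "\<And>x c. c \<in> k \<Longrightarrow> x \<in> B \<Longrightarrow> c *s x \<in> B"
  "\<And>x. x \<in> B \<Longrightarrow> quaternion_conj x \<in> B" "\<And>x. x \<in> B \<Longrightarrow> conj_by_i x \<in> B"
  using a b by (auto simp: B_iff quaternion_defs intro!: k_closed)

lemma \<rho>_hom:
  "\<rho> quaternion_one = mat 1" "\<And>x y. x \<in> B \<Longrightarrow> y \<in> B \<Longrightarrow> \<rho> (x \<cdot> y) = \<rho> x ** \<rho> y"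
  "\<And>x y. x \<in> B \<Longrightarrow> y \<in> B \<Longrightarrow> \<rho> (x + y) = \<rho> x + \<rho> y"
  "\<And>x c. c \<in> k \<Longrightarrow> x \<in> B \<Longrightarrow> \<rho> (c *s x) = mat (\<sigma> c) ** \<rho> x"
  using \<rho> unfolding algebra_embedding_def ring_hom_def
  by (simp_all add: M2C_def quaternion_algebra_def quaternion_one_def)

lemma \<rho>_scalar: "c \<in> k \<Longrightarrow> \<rho> (c *s quaternion_one) = mat (\<sigma> c)"
  using \<rho>_hom(1,4) B_closed(1) by simp

lemma \<rho>_uminus:
  assumes "x \<in> B"
  shows "\<rho> (- x) = - \<rho> x"
proof -
  have "\<rho> (- x) = \<rho> ((-1) *s x)" by simp
  also have "\<dots> = mat (\<sigma> (-1)) ** \<rho> x"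
    using k_closed(2,5) assms by (intro \<rho>_hom)
  also have "\<dots> = - \<rho> x"
    using \<sigma>_uminus[of 1] k_closed(2)
    by (simp add: \<sigma>_hom Finite_Cartesian_Product.vec_eq_iff mat_mult_component)
  finally show ?thesis .
qed

lemma \<sigma>_nonzero:
  assumes "c \<in> k" "c \<noteq> 0"
  shows "\<sigma> c \<noteq> 0"
proof
  assume "\<sigma> c = 0"
  then have "\<rho> (c *s quaternion_one) = \<rho> (0 *s quaternion_one)"
    by (simp only: \<rho>_scalar[OF assms(1)] \<rho>_scalar[OF k_closed(1)] \<sigma>_0)
  moreover have "inj_on \<rho> B" using \<rho> by (simp add: algebra_embedding_def)
  moreover have "c *s quaternion_one \<in> B" "0 *s quaternion_one \<in> B"
    by (rule B_closed(6)[OF _ B_closed(1)], rule assms k_closed)+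
  ultimately have "c *s quaternion_one = 0 *s quaternion_one" by (auto dest: inj_onD)
  then show False using assms(2) by (simp add: quaternion_defs)
qed

lemma \<rho>_i_sq: "\<rho> quaternion_i ** \<rho> quaternion_i = mat (\<sigma> a)"
proof -
  have "quaternion_i \<cdot> quaternion_i = a *s quaternion_one" by (simp add: quaternion_defs)
  then show ?thesis using \<rho>_hom(2)[OF B_closed(2,2)] \<rho>_scalar[OF a(1)] by simp
qed

lemma \<rho>_j_sq: "\<rho> quaternion_j ** \<rho> quaternion_j = mat (\<sigma> b)"
proof -
  have "quaternion_j \<cdot> quaternion_j = b *s quaternion_one" by (simp add: quaternion_defs)
  then show ?thesis using \<rho>_hom(2)[OF B_closed(3,3)] \<rho>_scalar[OF b(1)] by simp
qed

lemma \<rho>_ij: "\<rho> quaternion_j ** \<rho> quaternion_i = - (\<rho> quaternion_i ** \<rho> quaternion_j)"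
proof -
  have "quaternion_j \<cdot> quaternion_i = - (quaternion_i \<cdot> quaternion_j)" by (simp add: quaternion_defs)
  then show ?thesis
    using \<rho>_hom(2)[OF B_closed(3,2)] \<rho>_hom(2)[OF B_closed(2,3)] \<rho>_uminus[OF B_closed(4)[OF B_closed(2,3)]]
    by simp
qed

text \<open>No explicit matrices are known, but the relations force trace 0 on \<open>i\<close>,
  \<open>j\<close> and \<open>ij\<close>: \<open>i\<close> and \<open>j\<close> anticommute and have
  non-zero scalar squares, while \<open>ij\<close> and \<open>ji = - ij\<close> have equal
  traces.\<close>

lemma trace_\<rho>:
  assumes "x \<in> B"
  shows "trace (\<rho> x) = 2 * \<sigma> (x $ 1)"
proof -
  let ?I = "\<rho> quaternion_i" and ?J = "\<rho> quaternion_j"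
  have x: "\<And>n. x $ n \<in> k" using assms by (simp add: B_iff)
  have "x = x $ 1 *s quaternion_one + (x $ 2 *s quaternion_i + (x $ 3 *s quaternion_j
      + x $ 4 *s (quaternion_i \<cdot> quaternion_j)))"
    by (simp add: quaternion_defs)
  then have "\<rho> x = \<rho> (x $ 1 *s quaternion_one + (x $ 2 *s quaternion_i + (x $ 3 *s quaternion_j
      + x $ 4 *s (quaternion_i \<cdot> quaternion_j))))"
    by (rule arg_cong)
  also have "\<dots> = mat (\<sigma> (x $ 1)) ** mat 1 + (mat (\<sigma> (x $ 2)) ** ?I
      + (mat (\<sigma> (x $ 3)) ** ?J + mat (\<sigma> (x $ 4)) ** (?I ** ?J)))"
    using x by (simp only: \<rho>_hom B_closed)
  finally have "trace (\<rho> x) = 2 * \<sigma> (x $ 1) + \<sigma> (x $ 2) * trace ?I + \<sigma> (x $ 3) * trace ?J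
      + \<sigma> (x $ 4) * trace (?I ** ?J)"
    by (simp add: trace_2 mat_mult_component del: matrix_mul_rid) (simp add: mat_def algebra_simps)
  moreover have "trace ?I = 0"
    using trace_eq_0_if_anticommute[OF _ \<rho>_j_sq \<sigma>_nonzero[OF b], of ?I] \<rho>_ij by simp
  moreover have "trace ?J = 0"
    using trace_eq_0_if_anticommute[OF \<rho>_ij \<rho>_i_sq \<sigma>_nonzero[OF a]] .
  moreover have "trace (?I ** ?J) = 0"
  proof -
    have "trace (?I ** ?J) = trace (- (?I ** ?J))"
      using trace_mul_sym[of ?I ?J] unfolding \<rho>_ij .
    also have "\<dots> = - trace (?I ** ?J)" by (simp add: trace_2)
    finally show ?thesis by simp
  qed
  ultimately show ?thesis by simp
qed

text \<open>The sum of \<open>x\<close> and its conjugate is a scalar that maps to the trace of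
  \<open>\<rho> x\<close>, so the conjugate maps to the adjugate. In particular norm one elements
  get determinant 1.\<close>

lemma det_\<rho>:
  assumes "x \<in> B"
  shows "det (\<rho> x) = \<sigma> (reduced_norm a b x)"
proof (rule det_eq_if_adjugate)
  have x: "\<And>n. x $ n \<in> k" using assms by (simp add: B_iff)
  have eq: "x + quaternion_conj x = (x $ 1 + x $ 1) *s quaternion_one"
    by (simp add: quaternion_defs)
  have "\<rho> x + \<rho> (quaternion_conj x) = \<rho> (x + quaternion_conj x)"
    using \<rho>_hom(3)[OF assms B_closed(7)[OF assms]] ..
  also have "\<dots> = mat (\<sigma> (x $ 1 + x $ 1))"
    unfolding eq by (rule \<rho>_scalar[OF k_closed(3)[OF x x]])
  finally have "\<rho> x + \<rho> (quaternion_conj x) = mat (\<sigma> (x $ 1 + x $ 1))" .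
  then show "\<rho> x + \<rho> (quaternion_conj x) = mat (trace (\<rho> x))"
    unfolding \<sigma>_hom(3)[OF x x] trace_\<rho>[OF assms] mult_2 .
  have "reduced_norm a b x \<in> k"
    unfolding reduced_norm_def power2_eq_square using x a b by (intro k_closed)
  then show "\<rho> x ** \<rho> (quaternion_conj x) = mat (\<sigma> (reduced_norm a b x))"
    using \<rho>_hom(2)[OF assms B_closed(7)[OF assms]] \<rho>_scalar by (simp add: mult_quaternion_conj)
qed

text \<open>At norm one the conjugate is the inverse. This serves both for
  \<open>\<O>\<^sup>1\<close> and for its intersection with the conjugate by
  \<open>i\<close>.\<close>

lemma subgroup_norm_one:
  assumes U: "U \<subseteq> {x \<in> B. reduced_norm a b x = 1}" "quaternion_one \<in> U"
    and mult: "\<And>x y. x \<in> U \<Longrightarrow> y \<in> U \<Longrightarrow> x \<cdot> y \<in> U"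
    and conj: "\<And>x. x \<in> U \<Longrightarrow> quaternion_conj x \<in> U"
  shows "subgroup (PSL_proj ` \<rho> ` U) PSL2C"
    and "\<And>x. x \<in> U \<Longrightarrow> inv\<^bsub>PSL2C\<^esub> PSL_proj (\<rho> x) = PSL_proj (\<rho> (quaternion_conj x))"
    and "\<And>x y. x \<in> U \<Longrightarrow> y \<in> U \<Longrightarrow>
      PSL_proj (\<rho> x) \<otimes>\<^bsub>PSL2C\<^esub> PSL_proj (\<rho> y) = PSL_proj (\<rho> (x \<cdot> y))"
proof -
  interpret group PSL2C by (rule group_PSL2C)
  have UB: "x \<in> B" "reduced_norm a b x = 1" if "x \<in> U" for x
    using that U by auto
  have det: "det (\<rho> x) = 1" if "x \<in> U" for x
    using det_\<rho> UB[OF that] \<sigma>_hom(1) by simp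
  show m: "PSL_proj (\<rho> x) \<otimes>\<^bsub>PSL2C\<^esub> PSL_proj (\<rho> y) = PSL_proj (\<rho> (x \<cdot> y))"
    if "x \<in> U" "y \<in> U" for x y
    using that by (simp add: mult_PSL2C det \<rho>_hom(2) UB)
  have carr: "PSL_proj (\<rho> x) \<in> carrier PSL2C" if "x \<in> U" for x
    using det[OF that] by (auto simp: carrier_PSL2C)
  show i: "inv\<^bsub>PSL2C\<^esub> PSL_proj (\<rho> x) = PSL_proj (\<rho> (quaternion_conj x))" if "x \<in> U" for x
  proof (rule inv_equality)
    show "PSL_proj (\<rho> (quaternion_conj x)) \<otimes>\<^bsub>PSL2C\<^esub> PSL_proj (\<rho> x) = \<one>\<^bsub>PSL2C\<^esub>"
      using that conj by (simp add: m mult_quaternion_conj UB one_PSL2C \<rho>_hom(1))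
  qed (use that conj carr in auto)
  show "subgroup (PSL_proj ` \<rho> ` U) PSL2C"
  proof (rule subgroupI)
    show "PSL_proj ` \<rho> ` U \<noteq> {}" using U(2) by blast
  qed (use carr i m conj mult in auto)
qed

section \<open>The norm one group and its conjugate by \<open>i\<close>\<close>

definition norm_one_units where "norm_one_units = norm_one_group a b \<O>"

text \<open>This is \<open>\<O>\<^sup>1 \<inter> i\<O>\<^sup>1i\<^sup>-\<^sup>1\<close>: as
  \<open>conj_by_i\<close> is an involution preserving the reduced norm, only membership in
  \<open>\<O>\<close> has to be demanded.\<close>

definition norm_one_units_inter where "norm_one_units_inter = {x \<in> norm_one_units. conj_by_i x \<in> \<O>}"

lemma norm_one_units:
  "norm_one_units \<subseteq> {x \<in> B. reduced_norm a b x = 1}" "quaternion_one \<in> norm_one_units"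
  "\<And>x y. x \<in> norm_one_units \<Longrightarrow> y \<in> norm_one_units \<Longrightarrow> x \<cdot> y \<in> norm_one_units"
  "\<And>x. x \<in> norm_one_units \<Longrightarrow> quaternion_conj x \<in> norm_one_units"
  using order_subset_B order_closed quaternion_conj_mem
  by (auto simp: norm_one_units_def norm_one_group_def reduced_norm_mult)

lemma norm_one_units_inter:
  "norm_one_units_inter \<subseteq> {x \<in> B. reduced_norm a b x = 1}" "quaternion_one \<in> norm_one_units_inter"
  "\<And>x y. x \<in> norm_one_units_inter \<Longrightarrow> y \<in> norm_one_units_inter \<Longrightarrow> x \<cdot> y \<in> norm_one_units_inter"
  "\<And>x. x \<in> norm_one_units_inter \<Longrightarrow> quaternion_conj x \<in> norm_one_units_inter"
  "\<And>x. x \<in> norm_one_units_inter \<Longrightarrow> conj_by_i x \<in> norm_one_units_inter"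
  using norm_one_units order_closed quaternion_conj_mem
  by (auto simp: norm_one_units_inter_def conj_by_i_mult conj_by_i_one conj_by_i_quaternion_conj)
     (auto simp: norm_one_units_def norm_one_group_def)

text \<open>If \<open>x \<equiv> y\<close> modulo \<open>n\<O>\<close> then \<open>x y\<^sup>-\<^sup>1 \<in> 1 + n\<O>\<close>, and \<open>n\<close> is chosen such that
  \<open>n i\<O>i\<^sup>-\<^sup>1 \<subseteq> \<O>\<close>.\<close>

lemma finite_index_norm_one_units_inter:
  "finite_index PSL2C (PSL_proj ` \<rho> ` norm_one_units_inter) (PSL_proj ` \<rho> ` norm_one_units)"
proof -
  interpret group PSL2C by (rule group_PSL2C)
  obtain n :: nat where n: "n > 0" "\<And>x. x \<in> \<O> \<Longrightarrow> of_nat n *s conj_by_i x \<in> \<O>"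
    using conj_by_i_denominator by blast
  obtain cls :: "complex^4 \<Rightarrow> complex^4" where cls: "finite (cls ` \<O>)"
    "\<And>x y. x \<in> \<O> \<Longrightarrow> y \<in> \<O> \<Longrightarrow> cls x = cls y \<Longrightarrow> \<exists>z\<in>\<O>. x - y = of_nat n *s z"
    using order_classes[OF n(1)] by metis
  \<comment> \<open>Residue classes belong to quaternions, while an element of \<open>PSL2C\<close>
    determines its norm one preimage only up to sign; hence a choice.\<close>
  define r where "r g = (SOME x. x \<in> norm_one_units \<and> PSL_proj (\<rho> x) = g)" for g
  have r: "r g \<in> norm_one_units \<and> PSL_proj (\<rho> (r g)) = g" if "g \<in> PSL_proj ` \<rho> ` norm_one_units" for g
    unfolding r_def by (rule someI_ex) (use that in auto)
  have units_subset: "norm_one_units \<subseteq> \<O>" by (auto simp: norm_one_units_def norm_one_group_def)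
  show ?thesis
  proof (rule finite_indexI[where f = "\<lambda>g. cls (r g)"])
    show "subgroup (PSL_proj ` \<rho> ` norm_one_units_inter) PSL2C"
      by (rule subgroup_norm_one) (use norm_one_units_inter in auto)
    have "subgroup (PSL_proj ` \<rho> ` norm_one_units) PSL2C"
      by (rule subgroup_norm_one) (use norm_one_units in auto)
    then show "PSL_proj ` \<rho> ` norm_one_units \<subseteq> carrier PSL2C" by (rule subgroup.subset)
    have "(\<lambda>g. cls (r g)) ` PSL_proj ` \<rho> ` norm_one_units \<subseteq> cls ` \<O>"
      using r units_subset by blast
    then show "finite ((\<lambda>g. cls (r g)) ` PSL_proj ` \<rho> ` norm_one_units)"
      using cls(1) by (rule finite_subset)
  next
    fix g h assume gh: "g \<in> PSL_proj ` \<rho> ` norm_one_units" "h \<in> PSL_proj ` \<rho> ` norm_one_units" "cls (r g) = cls (r h)"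
    define x y where "x = r g" "y = r h"
    have x: "x \<in> norm_one_units" "g = PSL_proj (\<rho> x)" and y: "y \<in> norm_one_units" "h = PSL_proj (\<rho> y)"
      using r[OF gh(1)] r[OF gh(2)] by (simp_all add: x_y_def)
    then have "x \<in> \<O>" "y \<in> \<O>" using units_subset by auto
    then obtain z where z: "z \<in> \<O>" "x - y = of_nat n *s z"
      using cls(2) gh(3) by (auto simp: x_y_def)
    have yc: "quaternion_conj y \<in> norm_one_units" using norm_one_units(4) y by blast
    have "x = y + of_nat n *s z" using z(2) by (simp add: algebra_simps)
    then have "x \<cdot> quaternion_conj y = quaternion_one + of_nat n *s (z \<cdot> quaternion_conj y)"
      using norm_one_units(1) y by (auto simp: quaternion_mult_add quaternion_mult_scale mult_quaternion_conj)
    then have "conj_by_i (x \<cdot> quaternion_conj y)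
        = quaternion_one + of_nat n *s conj_by_i (z \<cdot> quaternion_conj y)"
      by (simp add: conj_by_i_linear conj_by_i_one)
    moreover have "of_nat n *s conj_by_i (z \<cdot> quaternion_conj y) \<in> \<O>"
      using z(1) yc units_subset by (intro n order_closed) auto
    ultimately have "conj_by_i (x \<cdot> quaternion_conj y) \<in> \<O>"
      using order_closed(2,3) by simp
    then have "x \<cdot> quaternion_conj y \<in> norm_one_units_inter"
      using norm_one_units(3)[OF x(1) yc] by (simp add: norm_one_units_inter_def)
    moreover have "g \<otimes>\<^bsub>PSL2C\<^esub> inv\<^bsub>PSL2C\<^esub> h = PSL_proj (\<rho> (x \<cdot> quaternion_conj y))"
      using subgroup_norm_one(2,3)[OF norm_one_units] x y yc by simp
    ultimately show "g \<otimes>\<^bsub>PSL2C\<^esub> inv\<^bsub>PSL2C\<^esub> h \<in> PSL_proj ` \<rho> ` norm_one_units_inter" by blast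
  qed
qed

lemma normalizing_involution:
  "\<exists>A. det A = 1 \<and> A ** A = - mat 1 \<and> (\<forall>x\<in>B. A ** \<rho> x = \<rho> (conj_by_i x) ** A)"
proof -
  \<comment> \<open>\<open>- \<sigma> a\<close> is the determinant of
    \<open>\<rho> quaternion_i\<close>. Division by its square root \<open>w\<close> makes the
    determinant 1 and the square \<open>\<sigma> a / w\<^sup>2 = -1\<close>.\<close>
  obtain w where w: "w\<^sup>2 = - \<sigma> a" using power2_csqrt by blast
  then have "w \<noteq> 0" using \<sigma>_nonzero[OF a] by auto
  define A where "A = mat (1 / w) ** \<rho> quaternion_i"
  have "reduced_norm a b quaternion_i = - a" by (simp add: quaternion_defs)
  then have "det (\<rho> quaternion_i) = w\<^sup>2"
    using det_\<rho>[OF B_closed(2)] \<sigma>_uminus[OF a(1)] w by simp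
  then have det: "det A = 1"
    using \<open>w \<noteq> 0\<close> by (simp add: A_def det_scalar_mult power_divide)
  have scal: "mat c ** M = M ** mat c" for c and M :: "complex^2^2"
    by (simp add: matrix_matrix_mult_def mat_def Finite_Cartesian_Product.vec_eq_iff forall_2 sum_2)
  have "A ** A = mat (1 / w) ** (\<rho> quaternion_i ** mat (1 / w)) ** \<rho> quaternion_i"
    by (simp add: A_def matrix_mul_assoc)
  also have "\<dots> = mat (1 / w) ** (mat (1 / w) ** \<rho> quaternion_i) ** \<rho> quaternion_i"
    unfolding scal[of "1 / w" "\<rho> quaternion_i"] ..
  finally have AA: "A ** A = mat (1 / w) ** (mat (1 / w) ** (\<rho> quaternion_i ** \<rho> quaternion_i))"
    by (simp only: matrix_mul_assoc)
  have "\<sigma> a = - w\<^sup>2" using w by simp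
  then have sq: "A ** A = - mat 1"
    unfolding AA \<rho>_i_sq using \<open>w \<noteq> 0\<close>
    by (simp add: Finite_Cartesian_Product.vec_eq_iff mat_mult_component)
       (simp add: mat_def power2_eq_square)
  have "A ** \<rho> x = \<rho> (conj_by_i x) ** A" if x: "x \<in> B" for x
  proof -
    have "\<rho> quaternion_i ** \<rho> x = \<rho> (conj_by_i x) ** \<rho> quaternion_i"
      using quaternion_i_mult[of a b x] \<rho>_hom(2)[OF B_closed(2) x]
        \<rho>_hom(2)[OF B_closed(8)[OF x] B_closed(2)] by simp
    then have "mat (1 / w) ** (\<rho> quaternion_i ** \<rho> x) = (mat (1 / w) ** \<rho> (conj_by_i x)) ** \<rho> quaternion_i"
      by (simp add: matrix_mul_assoc)
    then show ?thesis unfolding A_def scal[of _ "\<rho> (conj_by_i x)"] by (simp add: matrix_mul_assoc)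
  qed
  with det sq show ?thesis by blast
qed

end

theorem theorem1p1:
  fixes \<Gamma> :: "(complex^2^2) set set"
  assumes "arithmetic_Kleinian \<Gamma>" and "torsion_free PSL2C \<Gamma>"
  shows "\<exists>\<Gamma>\<^sub>0. arithmetic_Kleinian \<Gamma>\<^sub>0 \<and>
           orbifold_commensurable \<Gamma> \<Gamma>\<^sub>0 \<and> singular_locus \<Gamma>\<^sub>0 \<noteq> {} \<and>
           commensurable PSL2C \<Gamma> \<Gamma>\<^sub>0 \<and> (\<exists>g\<in>\<Gamma>\<^sub>0. group.ord PSL2C g = 2)"
proof -
  interpret group PSL2C by (rule group_PSL2C)
  have \<Gamma>: "subgroup \<Gamma> PSL2C" using assms(1) by (simp add: arithmetic_Kleinian_def)
  obtain k a b \<sigma> \<rho> \<O> where *: "number_field k" "card (complex_places k) = 1"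
      "a \<in> k - {0}" "b \<in> k - {0}" "\<forall>\<tau>\<in>real_embeddings k. ramified_at a b \<tau>"
      "\<sigma> \<in> complex_embeddings k" "algebra_embedding k a b \<sigma> \<rho>" "quaternion_order k a b \<O>"
    and comm: "commensurable PSL2C \<Gamma> (PSL_proj ` \<rho> ` norm_one_group a b \<O>)"
    using assms(1) unfolding arithmetic_Kleinian_def by blast
  interpret embedded_order k a b \<O> \<sigma> \<rho>
    by unfold_locales (use * in \<open>auto simp: complex_embeddings_def\<close>)
  define K where "K = PSL_proj ` \<rho> ` norm_one_units"
  define H where "H = PSL_proj ` \<rho> ` norm_one_units_inter"
  have K: "subgroup K PSL2C" unfolding K_def by (rule subgroup_norm_one) (use norm_one_units in auto)
  have H: "subgroup H PSL2C" unfolding H_def by (rule subgroup_norm_one) (use norm_one_units_inter in auto)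
  obtain A where A: "det A = 1" "A ** A = - mat 1"
    and conj: "\<And>x. x \<in> B \<Longrightarrow> A ** \<rho> x = \<rho> (conj_by_i x) ** A"
    using normalizing_involution by blast
  define g where "g = PSL_proj A"
  have g: "g \<in> carrier PSL2C" using A(1) by (auto simp: g_def carrier_PSL2C)
  \<comment> \<open>In \<open>PSL2C\<close> the matrices \<open>mat 1\<close> and
    \<open>- mat 1\<close> are identified, so \<open>A ** A = - mat 1\<close> makes \<open>g\<close>
    square to the identity.\<close>
  have gg: "g \<otimes>\<^bsub>PSL2C\<^esub> g = \<one>\<^bsub>PSL2C\<^esub>"
    using A by (simp add: g_def mult_PSL2C one_PSL2C PSL_proj_eq_iff)
  have "(mat 1 :: complex^2^2) \<noteq> - mat 1"
    by (simp add: Finite_Cartesian_Product.vec_eq_iff mat_def forall_2)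
  \<comment> \<open>If \<open>A\<close> were \<open>mat 1\<close> or \<open>- mat 1\<close>, its
    square would be \<open>mat 1\<close> and not \<open>- mat 1\<close>.\<close>
  then have g1: "g \<noteq> \<one>\<^bsub>PSL2C\<^esub>"
    using A(2) by (auto simp: g_def one_PSL2C PSL_proj_eq_iff matrix_mult_uminus)
  have gHg: "g \<otimes>\<^bsub>PSL2C\<^esub> h \<otimes>\<^bsub>PSL2C\<^esub> g \<in> H" if "h \<in> H" for h
  proof -
    obtain x where x: "x \<in> norm_one_units_inter" "h = PSL_proj (\<rho> x)" using \<open>h \<in> H\<close> by (auto simp: H_def)
    have y: "conj_by_i x \<in> norm_one_units_inter" using norm_one_units_inter(5) x by blast
    have B: "x \<in> B" "reduced_norm a b x = 1" using x norm_one_units_inter(1) by auto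
    then have det: "det (\<rho> x) = 1" "det (\<rho> (conj_by_i x)) = 1"
      using det_\<rho> B_closed(8) \<sigma>_hom(1) by auto
    have "g \<otimes>\<^bsub>PSL2C\<^esub> h = PSL_proj (\<rho> (conj_by_i x)) \<otimes>\<^bsub>PSL2C\<^esub> g"
      using A(1) det conj[OF B(1)] by (simp add: g_def x(2) mult_PSL2C)
    moreover have "PSL_proj (\<rho> (conj_by_i x)) \<in> carrier PSL2C"
      using det by (auto simp: carrier_PSL2C)
    ultimately have "g \<otimes>\<^bsub>PSL2C\<^esub> h \<otimes>\<^bsub>PSL2C\<^esub> g = PSL_proj (\<rho> (conj_by_i x))"
      using g gg by (simp add: m_assoc)
    then show ?thesis using y by (simp add: H_def)
  qed
  define \<Gamma>\<^sub>0 where "\<Gamma>\<^sub>0 = H \<union> (\<lambda>h. g \<otimes>\<^bsub>PSL2C\<^esub> h) ` H"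
  have \<Gamma>\<^sub>0: "subgroup \<Gamma>\<^sub>0 PSL2C" "finite_index PSL2C H \<Gamma>\<^sub>0"
    unfolding \<Gamma>\<^sub>0_def using involution_extension[OF H g gg gHg] by blast+
  have KG: "commensurable PSL2C K \<Gamma>\<^sub>0"
  proof (rule commensurable_if_common_subgroup[OF _ \<Gamma>\<^sub>0(2) _ _ H K \<Gamma>\<^sub>0(1)])
    show "finite_index PSL2C H K" using finite_index_norm_one_units_inter by (simp add: H_def K_def)
    show "H \<subseteq> K" by (auto simp: H_def K_def norm_one_units_inter_def)
    show "H \<subseteq> \<Gamma>\<^sub>0" by (simp add: \<Gamma>\<^sub>0_def)
  qed
  then have "commensurable PSL2C \<Gamma>\<^sub>0 (PSL_proj ` \<rho> ` norm_one_group a b \<O>)"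
    by (simp add: commensurable_def K_def norm_one_units_def Int_commute)
  \<comment> \<open>The field, algebra, embedding and order obtained for \<open>\<Gamma>\<close>
    serve again as witnesses.\<close>
  then have "arithmetic_Kleinian \<Gamma>\<^sub>0"
    unfolding arithmetic_Kleinian_def using \<Gamma>\<^sub>0(1) *
    by (intro conjI exI[of _ k] exI[of _ a] exI[of _ b] exI[of _ \<sigma>] exI[of _ \<rho>] exI[of _ \<O>])
  moreover have comm0: "commensurable PSL2C \<Gamma> \<Gamma>\<^sub>0"
    by (rule commensurable_trans[OF _ KG \<Gamma> K \<Gamma>\<^sub>0(1)]) (use comm in \<open>simp add: K_def norm_one_units_def\<close>)
  moreover have "orbifold_commensurable \<Gamma> \<Gamma>\<^sub>0"
    using comm0 \<Gamma> \<Gamma>\<^sub>0(1) by (rule orbifold_commensurable_if_commensurable)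
  moreover have "g \<in> \<Gamma>\<^sub>0"
    using subgroup.one_closed[OF H] g by (force simp: \<Gamma>\<^sub>0_def)
  moreover have "singular_locus \<Gamma>\<^sub>0 \<noteq> {}"
  proof -
    obtain p where "p \<in> H3" "Poincare_extension A p = p" using involution_fixed_point[OF A] by blast
    then have "p \<in> H3" "PSL_act g p = p" by (simp_all add: g_def PSL_act_proj)
    then show ?thesis
      unfolding singular_locus_def using \<open>g \<in> \<Gamma>\<^sub>0\<close> g1 by blast
  qed
  moreover have "ord g = 2" using g g1 gg by (rule ord_eq_2)
  ultimately show ?thesis by blast
qed

end
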